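(* Let $1\le l\le d$ and let $X_0,X_1,\dots,X_l$ be independent standard Gaussian vectors in $\mathbb{R}^d$. Then for all $\sigma_0,\dots,\sigma_l>0$ and all $p>0$, $$\mathbb E|\mathrm{conv}(\sigma_0X_0,\dots,\sigma_lX_l)|^p=\Bigg[\frac{2^{l/2}\sigma_0\cdots\sigma_l}{l!}\sqrt{\frac1{\sigma_0^2}+\dots+\frac1{\sigma_l^2}}\Bigg]^p\prod_{i=d-l+1}^{d}\frac{\Gamma(\frac{i+p}2)}{\Gamma(\frac i2)}.$$
   Context: $|\cdot|$ denotes $l$-dimensional volume (Lebesgue measure in the affine hull) of the simplex. *)

theory Defs
  imports "HOL-Probability.Probability"
begin

text \<open>The l-dimensional volume of a set S in R^d lying in an l-dimensional affine
subspace: Lebesgue measure (in R^l) of the preimage of S under an isometric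
(hence affine) embedding of R^l into R^d whose image contains S.  Here
l = CARD('l).\<close>
definition vol_l :: "'l::finite itself \<Rightarrow> (real^'d::finite) set \<Rightarrow> real" where
  "vol_l _ S = measure lebesgue
     ((SOME f :: real^'l \<Rightarrow> real^'d. (\<forall>x y. dist (f x) (f y) = dist x y) \<and> S \<subseteq> range f) -` S)"

definition std_gaussian :: "(real^'d::finite) measure" where
  "std_gaussian = density lborel
     (\<lambda>x. ennreal ((2 * pi) powr (- real CARD('d) / 2) * exp (- (norm x)\<^sup>2 / 2)))"

end

theory Submission
  imports Defs
begin

text \<open>
  With \<open>s\<^sub>i = \<sigma>\<^sub>0 / \<sigma>\<^sub>i\<close>, the edge vectors of the simplex are \<open>\<sigma>\<^sub>i (X\<^sub>i - s\<^sub>i X\<^sub>0)\<close>, and its volume is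
  \<open>1 / l!\<close> times the square root of their Gram determinant. The factors \<open>\<sigma>\<^sub>i\<close> come out of the
  determinant, and by rotation invariance of the Gaussian measure replacing \<open>X\<^sub>i - s\<^sub>i X\<^sub>0\<close> by \<open>X\<^sub>i\<close>
  only costs the factor \<open>1 + |s|\<^sup>2\<close>. The Gram determinant of \<open>l\<close> independent standard Gaussian vectors
  is the product of the squared lengths of their Gram-Schmidt residuals. Given the first \<open>k\<close> vectors,
  the squared length of the next residual is a chi-squared variable with \<open>d - k\<close> degrees of freedom,
  so the moments multiply.
\<close>

text \<open>The volume is defined through an arbitrarily chosen isometric embedding, so it has to be
  expressed by data that every isometry preserves. The Gram matrix of the edge vectors is such data,
  and the resulting volume formula holds pointwise, degenerate simplices included. The factor 1 +
  |s|^2 is the determinant of I + s s^T, the covariance between the rows X_i - s_i X_0. It equals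
  \<sigma>_0^2 times the sum of all 1 / \<sigma>_i^2, which is where the square root in the formula
  comes from. A residual with n = d - k degrees of freedom contributes 2^(p/2) Gamma((n + p)/2) /
  Gamma(n/2). For k < l the numbers n run through d - l + 1, ..., d, and the l factors 2^(p/2)
  combine to (2^(l/2))^p. All moments are computed as integrals with values in [0, \<infinity>], so
  that Fubini and constant factors raise no question of integrability; the expectation enters only
  at the end.\<close>

section \<open>Rotation invariance of the Gaussian measure\<close>

text \<open>
  The argument is the uniqueness of translation-invariant measures: evaluating
  \<open>\<integral>\<integral> 1\<^sub>A(T u) 1\<^sub>B(T u - y) du dy\<close> in both orders shows that the two measures are proportional, and
  the unit ball fixes the factor.
\<close>
lemma lborel_distr_isometry:
  fixes T :: "'a::euclidean_space \<Rightarrow> 'b::euclidean_space"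
  assumes lin: "linear T" and norm: "\<And>x. norm (T x) = norm x" and dim: "DIM('a) = DIM('b)"
  shows "distr lborel borel T = lborel"
proof -
  have meas [measurable]: "T \<in> borel_measurable borel"
    by (intro borel_measurable_continuous_onI linear_continuous_on linear_conv_bounded_linear[THEN iffD1] lin)
  have inj: "inj T"
    using lin norm by (metis linear_injective_0 norm_eq_zero)
  have "dim (range T) = DIM('b)"
    using dim_image_eq[OF lin, of UNIV] inj dim by (simp add: dim_UNIV)
  hence surj: "surj T"
    by (metis dim_eq_full linear_subspace_image lin span_eq_iff subspace_UNIV)
  \<comment> \<open>Surjectivity turns a shift of the target by \<open>y = T v\<close> into a shift
    of the source by \<open>v\<close>.\<close>
  have shift: "(\<integral>\<^sup>+u. f (T u + y) \<partial>lborel) = (\<integral>\<^sup>+u. f (T u) \<partial>lborel)"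
    if [measurable]: "f \<in> borel_measurable borel" for f :: "'b \<Rightarrow> ennreal" and y
  proof -
    obtain v where v: "y = T v" using surj by (metis surjD)
    have "(\<integral>\<^sup>+u. f (T u) \<partial>lborel) = (\<integral>\<^sup>+u. f (T u) \<partial>distr lborel borel ((+) v))"
      by (simp add: lborel_distr_plus)
    also have "\<dots> = (\<integral>\<^sup>+u. f (T (v + u)) \<partial>lborel)"
      by (subst nn_integral_distr) auto
    finally show ?thesis by (simp add: v linear_add[OF lin] add.commute)
  qed
  have refl: "(\<integral>\<^sup>+y. f (x - y) \<partial>lborel) = (\<integral>\<^sup>+y. f y \<partial>lborel)"
    if [measurable]: "f \<in> borel_measurable borel" for f :: "'b \<Rightarrow> ennreal" and x
  proof -
    have "(\<integral>\<^sup>+y. f y \<partial>lborel) = (\<integral>\<^sup>+y. f y \<partial>density (distr lborel borel (\<lambda>y. x + (-1) *\<^sub>R y)) (\<lambda>_. ennreal (\<bar>-1\<bar> ^ DIM('b))))"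
      by (subst lborel_affine[of "-1" x]) auto
    also have "\<dots> = (\<integral>\<^sup>+y. f (x - y) \<partial>lborel)"
      by (simp add: nn_integral_density nn_integral_distr)
    finally show ?thesis ..
  qed
  have key: "emeasure (distr lborel borel T) A * emeasure lborel B
      = emeasure lborel A * emeasure (distr lborel borel T) B"
    if [measurable]: "A \<in> sets borel" "B \<in> sets borel" for A B
  proof -
    have T: "emeasure (distr lborel borel T) C = (\<integral>\<^sup>+u. indicator C (T u) \<partial>lborel)"
      if [measurable]: "C \<in> sets borel" for C
      by (subst nn_integral_indicator[symmetric], simp, subst nn_integral_distr) auto
    have "emeasure (distr lborel borel T) A * emeasure lborel B
        = (\<integral>\<^sup>+u. indicator A (T u) * (\<integral>\<^sup>+y. indicator B (T u - y) \<partial>lborel) \<partial>lborel)"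
      by (simp add: refl T nn_integral_multc)
    also have "\<dots> = (\<integral>\<^sup>+u. (\<integral>\<^sup>+y. indicator A (T u) * indicator B (T u - y) \<partial>lborel) \<partial>lborel)"
      by (simp add: nn_integral_cmult)
    also have "\<dots> = (\<integral>\<^sup>+y. (\<integral>\<^sup>+u. indicator A (T u) * indicator B (T u - y) \<partial>lborel) \<partial>lborel)"
      by (intro lborel_pair.Fubini') measurable
    also have "\<dots> = (\<integral>\<^sup>+y. (\<integral>\<^sup>+u. indicator A (T u + y) * indicator B (T u) \<partial>lborel) \<partial>lborel)"
      by (subst shift[of "\<lambda>z. indicator A z * indicator B (z - y)" y for y, symmetric]) auto
    also have "\<dots> = (\<integral>\<^sup>+u. (\<integral>\<^sup>+y. indicator A (T u + y) * indicator B (T u) \<partial>lborel) \<partial>lborel)"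
      by (intro lborel_pair.Fubini') measurable
    also have "\<dots> = (\<integral>\<^sup>+u. (\<integral>\<^sup>+y. indicator A (T u - y) * indicator B (T u) \<partial>lborel) \<partial>lborel)"
      using refl[of "\<lambda>y. indicator A (T u + y) * indicator B (T u)" 0 for u] by simp
    also have "\<dots> = emeasure lborel A * emeasure (distr lborel borel T) B"
      by (simp add: nn_integral_multc nn_integral_cmult refl T)
    finally show ?thesis .
  qed
  have "T -` ball 0 1 = ball 0 1"
    using norm by auto
  hence "emeasure (distr lborel borel T) (ball 0 1) = emeasure lborel (ball (0::'a) 1)"
    by (subst emeasure_distr) auto
  also have "\<dots> = emeasure lborel (ball (0::'b) 1)"
    by (simp add: emeasure_ball dim)
  finally have ball: "emeasure (distr lborel borel T) (ball 0 1) = emeasure lborel (ball (0::'b) 1)" .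
  show ?thesis
  proof (rule measure_eqI)
    fix A assume "A \<in> sets (distr lborel borel T)"
    hence "emeasure (distr lborel borel T) A * emeasure lborel (ball (0::'b) 1)
         = emeasure lborel A * emeasure lborel (ball (0::'b) 1)"
      using key[of A "ball 0 1"] ball by simp
    thus "emeasure (distr lborel borel T) A = emeasure lborel A"
      by (subst (asm) (1 2) mult.commute) (simp add: ennreal_mult_cancel_left emeasure_ball unit_ball_vol_pos[THEN less_imp_neq, THEN not_sym])
  qed simp
qed

text \<open>Defined on every Euclidean space, because the rotations below act not only on
  \<open>real^'d\<close> but also on vectors of such vectors and on pairs.\<close>

definition gauss :: "'a::euclidean_space measure" where
  "gauss = density lborel (\<lambda>x. ennreal ((2 * pi) powr (- real DIM('a) / 2) * exp (- (norm x)\<^sup>2 / 2)))"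

lemma sets_gauss [simp, measurable_cong]: "sets gauss = sets borel"
  by (simp add: gauss_def)

lemma space_gauss [simp]: "space gauss = UNIV"
  by (simp add: gauss_def)

lemma std_gaussian_eq_gauss: "std_gaussian = gauss"
  by (simp add: std_gaussian_def gauss_def)

text \<open>The density is a function of the norm alone, which \<open>T\<close> preserves, so only
  the invariance of Lebesgue measure is at stake.\<close>

lemma gauss_distr_isometry:
  fixes T :: "'a::euclidean_space \<Rightarrow> 'b::euclidean_space"
  assumes lin: "linear T" and norm: "\<And>x. norm (T x) = norm x" and dim: "DIM('a) = DIM('b)"
  shows "distr gauss borel T = gauss"
proof -
  have [measurable]: "T \<in> borel_measurable borel"
    by (intro borel_measurable_continuous_onI linear_continuous_on linear_conv_bounded_linear[THEN iffD1] lin)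
  have "gauss = density (distr lborel borel T)
      (\<lambda>x. ennreal ((2 * pi) powr (- real DIM('b) / 2) * exp (- (norm x)\<^sup>2 / 2)))"
    unfolding gauss_def by (subst lborel_distr_isometry[OF assms]) auto
  also have "\<dots> = distr gauss borel T"
    by (subst density_distr) (auto simp: gauss_def norm dim)
  finally show ?thesis ..
qed

text \<open>Product measures are determined by boxes, and on a box both the density and the
  indicator split into one factor per coordinate. This is used for scalar coordinates as well as for
  vector-valued ones.\<close>

lemma PiM_density:
  assumes "finite I" and M: "\<And>i. sigma_finite_measure (M i)"
    and [measurable]: "\<And>i. i \<in> I \<Longrightarrow> f i \<in> borel_measurable (M i)"
    and D: "\<And>i. sigma_finite_measure (density (M i) (f i))"
  shows "density (PiM I M) (\<lambda>x. \<Prod>i\<in>I. f i (x i)) = PiM I (\<lambda>i. density (M i) (f i))"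
proof -
  interpret M: product_sigma_finite M
    using M by (simp add: product_sigma_finite_def)
  interpret D: product_sigma_finite "\<lambda>i. density (M i) (f i)"
    using D by (simp add: product_sigma_finite_def)
  have [measurable]: "(\<lambda>x. \<Prod>i\<in>I. f i (x i)) \<in> borel_measurable (PiM I M)"
    by measurable
  show ?thesis
  proof (rule D.PiM_eqI)
    show "finite I" by fact
    show "sets (density (Pi\<^sub>M I M) (\<lambda>x. \<Prod>i\<in>I. f i (x i))) = sets (Pi\<^sub>M I (\<lambda>i. density (M i) (f i)))"
      by (simp cong: sets_PiM_cong)
    fix A assume "\<And>i. i \<in> I \<Longrightarrow> A i \<in> sets (density (M i) (f i))"
    hence A [measurable]: "\<And>i. i \<in> I \<Longrightarrow> A i \<in> sets (M i)" by simp
    have "emeasure (density (Pi\<^sub>M I M) (\<lambda>x. \<Prod>i\<in>I. f i (x i))) (Pi\<^sub>E I A)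
        = (\<integral>\<^sup>+x. (\<Prod>i\<in>I. f i (x i)) * indicator (Pi\<^sub>E I A) x \<partial>PiM I M)"
      using A \<open>finite I\<close> by (subst emeasure_density) (auto intro!: sets_PiM_I_finite)
    also have "\<dots> = (\<integral>\<^sup>+x. (\<Prod>i\<in>I. f i (x i) * indicator (A i) (x i)) \<partial>PiM I M)"
      using \<open>finite I\<close>
      by (intro nn_integral_cong)
         (auto simp: prod.distrib indicator_def space_PiM PiE_def Pi_def split: if_splits)
    also have "\<dots> = (\<Prod>i\<in>I. \<integral>\<^sup>+x. f i x * indicator (A i) x \<partial>M i)"
      using \<open>finite I\<close> A by (intro M.product_nn_integral_prod) auto
    also have "\<dots> = (\<Prod>i\<in>I. emeasure (density (M i) (f i)) (A i))"
      using A by (intro prod.cong refl) (simp add: emeasure_density)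
    finally show "emeasure (density (Pi\<^sub>M I M) (\<lambda>x. \<Prod>i\<in>I. f i (x i))) (Pi\<^sub>E I A)
      = (\<Prod>i\<in>I. emeasure (density (M i) (f i)) (A i))" .
  qed
qed

section \<open>Moments of the length of a Gaussian vector\<close>

lemma std_normal_density_prod:
  assumes "finite I"
  shows "(\<Prod>i\<in>I. std_normal_density (x i))
    = (2 * pi) powr (- real (card I) / 2) * exp (- (\<Sum>i\<in>I. (x i)\<^sup>2) / 2)"
  using assms
proof (induction I rule: finite_induct)
  case (insert i I)
  have "std_normal_density (x i) = (2 * pi) powr (-1/2) * exp (- (x i)\<^sup>2 / 2)"
    using powr_minus_divide[of "2 * pi" "1/2"]
    by (simp add: std_normal_density_def powr_half_sqrt)
  moreover have "(2 * pi) powr (- real (card (insert i I)) / 2)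
      = (2 * pi) powr (-1/2) * (2 * pi) powr (- real (card I) / 2)"
    using insert.hyps by (simp only: powr_add[symmetric]) (simp add: field_simps)
  moreover have "exp (- (\<Sum>j\<in>insert i I. (x j)\<^sup>2) / 2) = exp (- (x i)\<^sup>2 / 2) * exp (- (\<Sum>j\<in>I. (x j)\<^sup>2) / 2)"
    using insert.hyps by (simp only: exp_add[symmetric]) (simp add: field_simps)
  ultimately show ?case
    unfolding prod.insert[OF insert.hyps] insert.IH by simp
qed simp

abbreviation std_normal :: "real measure" where
  "std_normal \<equiv> density lborel (\<lambda>x. ennreal (std_normal_density x))"

lemma PiM_std_normal:
  assumes "finite I"
  shows "PiM I (\<lambda>_. std_normal) = density (PiM I (\<lambda>_. lborel))
     (\<lambda>x. ennreal ((2 * pi) powr (- real (card I) / 2) * exp (- (\<Sum>i\<in>I. (x i)\<^sup>2) / 2)))"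
proof -
  have "PiM I (\<lambda>_. std_normal) = density (PiM I (\<lambda>_. lborel)) (\<lambda>x. \<Prod>i\<in>I. ennreal (std_normal_density (x i)))"
    using assms prob_space_normal_density[of 1 0]
    by (intro PiM_density[symmetric] sigma_finite_lborel)
       (auto intro: prob_space_imp_sigma_finite)
  thus ?thesis
    by (simp add: prod_ennreal std_normal_density_prod assms)
qed

text \<open>By \<open>lborel_eq\<close> Lebesgue measure is itself an image of a product over the
  basis. Pulling the Gaussian density back along this map gives a product of one-dimensional
  densities, by Pythagoras.\<close>

lemma gauss_eq_distr_PiM:
  "(gauss :: 'a::euclidean_space measure)
     = distr (PiM Basis (\<lambda>_. std_normal)) borel (\<lambda>f. \<Sum>b\<in>Basis. f b *\<^sub>R b)"
proof -
  have norm: "(norm (\<Sum>b\<in>Basis. f b *\<^sub>R b :: 'a))\<^sup>2 = (\<Sum>b\<in>Basis. (f b)\<^sup>2)" for f :: "'a \<Rightarrow> real"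
    by (subst norm_sum_Pythagorean)
       (auto simp: pairwise_def orthogonal_def inner_Basis power_mult_distrib)
  show ?thesis
    unfolding gauss_def
    by (subst lborel_eq, subst density_distr) (auto simp: norm PiM_std_normal)
qed

lemma prob_space_gauss: "prob_space (gauss :: 'a::euclidean_space measure)"
proof -
  interpret prob_space "PiM (Basis :: 'a set) (\<lambda>_. std_normal)"
    using prob_space_normal_density[of 1 0] by (intro prob_space_PiM) auto
  show ?thesis
    unfolding gauss_eq_distr_PiM by (intro prob_space_distr) simp
qed

text \<open>This replaces polar coordinates. The set where half the squared length is at most t is a
  ball of radius sqrt(2t) and volume (2 pi t)^a / Gamma(a + 1); its derivative in t is the stated
  density. Halving the square makes the Gaussian weight exactly exp(-t).\<close>

lemma distr_lborel_PiM_sum_squares: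
  fixes I :: "'i set"
  assumes I: "finite I" "I \<noteq> {}"
  defines "a \<equiv> real (card I) / 2"
  shows "distr (PiM I (\<lambda>_. lborel)) borel (\<lambda>x. (\<Sum>i\<in>I. (x i)\<^sup>2) / 2)
    = density lborel (\<lambda>t. ennreal ((2 * pi) powr a / Gamma a) * ennreal (indicator {0..} t * t powr (a - 1)))"
    (is "?L = ?R")
proof (rule measure_eqI_generator_eq[where E = "range atMost" and \<Omega> = UNIV and A = "\<lambda>n. {..real n}"])
  have a: "a > 0"
    using I by (simp add: a_def card_gt_0_iff)
  have nonpos: "a \<notin> \<int>\<^sub>\<le>\<^sub>0"
    using a by (auto elim!: nonpos_Ints_cases)
  have vol: "unit_ball_vol (real (card I)) * 2 powr a = (2 * pi) powr a / Gamma a / a"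
    using a by (simp add: unit_ball_vol_def a_def[symmetric] powr_mult Gamma_plus1[OF nonpos, unfolded add.commute[of a]] Gamma_plus1[OF nonpos] field_simps)
  show "emeasure ?L X = emeasure ?R X" if rng: "X \<in> range atMost" for X
  proof -
    obtain t where X: "X = {..t}" using rng by blast
    show ?thesis
    proof (cases "t > 0")
      case True
      have eq: "(\<lambda>x. (\<Sum>i\<in>I. (x i)\<^sup>2) / 2) -` {..t} \<inter> space (PiM I (\<lambda>_. lborel))
          = {f. sqrt (\<Sum>i\<in>I. (f i)\<^sup>2) \<le> sqrt (2 * t)} \<inter> space (PiM I (\<lambda>_. lborel))"
        by auto
      have pw: "sqrt (2 * t) ^ card I = 2 powr a * t powr a"
        using True by (simp add: powr_half_sqrt[symmetric] powr_realpow[symmetric] powr_powr powr_mult a_def)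
      have "emeasure ?L X = emeasure (PiM I (\<lambda>_. lborel))
          ((\<lambda>x. (\<Sum>i\<in>I. (x i)\<^sup>2) / 2) -` {..t} \<inter> space (PiM I (\<lambda>_. lborel)))"
        unfolding X by (rule emeasure_distr) auto
      also have "\<dots> = ennreal (unit_ball_vol (real (card I)) * sqrt (2 * t) ^ card I)"
        unfolding eq using True I by (intro emeasure_cball_aux) auto
      also have "\<dots> = ennreal ((2 * pi) powr a / Gamma a) * ennreal (t powr a / a)"
        using a by (subst ennreal_mult[symmetric])
          (auto simp: pw vol Gamma_real_pos less_imp_le simp flip: mult.assoc)
      also have "ennreal (t powr a / a) = (\<integral>\<^sup>+s. ennreal (indicator {0..t} s * s powr (a - 1)) \<partial>lborel)"
        using nn_integral_has_integral_lebesgue[OF _ has_integral_powr_from_0[of "a - 1" t]] a True by simp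
      also have "ennreal ((2 * pi) powr a / Gamma a) * \<dots> = emeasure ?R X"
        unfolding X
        by (subst emeasure_density) (auto simp: nn_integral_cmult[symmetric] indicator_def intro!: nn_integral_cong)
      finally show ?thesis .
    next
      case False
      interpret product_sigma_finite "\<lambda>_::'i. lborel :: real measure"
        by standard
      \<comment> \<open>For \<open>t \<le> 0\<close> the sublevel set lies in the single point 0,
        which is a null set because \<open>I\<close> is nonempty.\<close>
      have sub: "x \<in> Pi\<^sub>E I (\<lambda>_. {0::real})"
        if "x \<in> space (PiM I (\<lambda>_. lborel :: real measure))" "(\<Sum>i\<in>I. (x i)\<^sup>2) / 2 \<le> t" for x
      proof -
        have "(\<Sum>i\<in>I. (x i)\<^sup>2) = 0"
          using that(2) False sum_nonneg[of I "\<lambda>i. (x i)\<^sup>2"] by simp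
        thus ?thesis
          unfolding PiE_iff using I that(1) by (auto simp: sum_nonneg_eq_0_iff space_PiM PiE_iff)
      qed
      have "emeasure ?L X = emeasure (PiM I (\<lambda>_. lborel))
          ((\<lambda>x. (\<Sum>i\<in>I. (x i)\<^sup>2) / 2) -` {..t} \<inter> space (PiM I (\<lambda>_. lborel)))"
        unfolding X by (rule emeasure_distr) auto
      also have "\<dots> \<le> emeasure (PiM I (\<lambda>_. lborel)) (Pi\<^sub>E I (\<lambda>_. {0::real}))"
      proof (rule emeasure_mono)
        show "(\<lambda>x. (\<Sum>i\<in>I. (x i)\<^sup>2) / 2) -` {..t} \<inter> space (PiM I (\<lambda>_. lborel)) \<subseteq> Pi\<^sub>E I (\<lambda>_. {0::real})"
          by (rule subsetI, rule sub) auto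
        show "Pi\<^sub>E I (\<lambda>_. {0::real}) \<in> sets (PiM I (\<lambda>_. lborel))"
          using I(1) by (rule sets_PiM_I_finite) auto
      qed
      also have "\<dots> = 0"
        using I by (subst emeasure_PiM) (auto simp: card_gt_0_iff)
      finally have "emeasure ?L X = 0" by simp
      moreover have "emeasure ?R X = (\<integral>\<^sup>+s. ennreal ((2 * pi) powr a / Gamma a)
          * ennreal (indicator {0..} s * s powr (a - 1)) * indicator {..t} s \<partial>lborel)"
        unfolding X by (rule emeasure_density) auto
      moreover have "\<dots> = (\<integral>\<^sup>+(s::real). 0 \<partial>lborel)"
        using False by (intro nn_integral_cong) (auto simp: indicator_def dest: order_trans antisym)
      ultimately show ?thesis by simp
    qed
  qed
  show "Int_stable (range atMost :: real set set)"
    by (auto simp: Int_stable_def)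
  show "sets ?L = sigma_sets UNIV (range atMost)" "sets ?R = sigma_sets UNIV (range atMost)"
    by (simp_all add: borel_eq_atMost)
  show "(\<Union>i. {..real i}) = UNIV"
    by (auto simp: real_arch_simple)
  show "emeasure ?L {..real i} \<noteq> \<infinity>" for i
  proof -
    \<comment> \<open>Passing to \<open>Suc i\<close> keeps the radius positive when
      \<open>i = 0\<close>, so that the ball volume applies.\<close>
    have eq: "(\<lambda>x. (\<Sum>i\<in>I. (x i)\<^sup>2) / 2) -` {..real (Suc i)} \<inter> space (PiM I (\<lambda>_. lborel))
        = {f. sqrt (\<Sum>i\<in>I. (f i)\<^sup>2) \<le> sqrt (2 * real (Suc i))} \<inter> space (PiM I (\<lambda>_. lborel))"
      by auto
    have "emeasure ?L {..real i} \<le> emeasure ?L {..real (Suc i)}"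
      by (intro emeasure_mono) auto
    also have "\<dots> = emeasure (PiM I (\<lambda>_. lborel))
        ((\<lambda>x. (\<Sum>i\<in>I. (x i)\<^sup>2) / 2) -` {..real (Suc i)} \<inter> space (PiM I (\<lambda>_. lborel)))"
      by (rule emeasure_distr) auto
    also have "\<dots> = ennreal (unit_ball_vol (real (card I)) * sqrt (2 * real (Suc i)) ^ card I)"
      unfolding eq using I by (intro emeasure_cball_aux) auto
    also have "\<dots> < \<infinity>" by simp
    finally show ?thesis by simp
  qed
qed auto

text \<open>The moments of the chi distribution: in the variable t, half the squared length, the
  integral becomes the Gamma integral of t^(a + p/2 - 1) exp(-t). The powers of 2 pi cancel, and
  sqrt(2t)^p leaves the factor 2^(p/2).\<close>

lemma nn_integral_sum_squares_powr:
  fixes I :: "'i set"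
  assumes I: "finite I" "I \<noteq> {}" and p: "p > 0"
  shows "(\<integral>\<^sup>+x. ennreal (sqrt (\<Sum>i\<in>I. (x i)\<^sup>2) powr p) \<partial>PiM I (\<lambda>_. std_normal))
    = ennreal (2 powr (p / 2) * Gamma ((real (card I) + p) / 2) / Gamma (real (card I) / 2))"
proof -
  define a where "a = real (card I) / 2"
  have a: "a > 0"
    using I by (simp add: a_def card_gt_0_iff)
  let ?c = "(2 * pi) powr a / Gamma a"
  let ?g = "\<lambda>t. ennreal ((2 * pi) powr (- a) * exp (- t)) * ennreal (sqrt (2 * t) powr p)"
  have "(\<integral>\<^sup>+x. ennreal (sqrt (\<Sum>i\<in>I. (x i)\<^sup>2) powr p) \<partial>PiM I (\<lambda>_. std_normal))
      = (\<integral>\<^sup>+x. ?g ((\<Sum>i\<in>I. (x i)\<^sup>2) / 2) \<partial>PiM I (\<lambda>_. lborel))"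
    using I by (subst PiM_std_normal) (simp_all add: nn_integral_density a_def)
  also have "\<dots> = (\<integral>\<^sup>+t. ?g t \<partial>distr (PiM I (\<lambda>_. lborel)) borel (\<lambda>x. (\<Sum>i\<in>I. (x i)\<^sup>2) / 2))"
    by (subst nn_integral_distr) auto
  also have "\<dots> = (\<integral>\<^sup>+t. ennreal ?c * ennreal (indicator {0..} t * t powr (a - 1)) * ?g t \<partial>lborel)"
    unfolding distr_lborel_PiM_sum_squares[OF I] a_def[symmetric]
    by (subst nn_integral_density) auto
  also have "\<dots> = (\<integral>\<^sup>+t. ennreal (2 powr (p / 2) / Gamma a) *
      ennreal (indicator {0..} t * t powr (a + p / 2 - 1) / exp t) \<partial>lborel)"
  proof (intro nn_integral_cong)
    fix t :: real
    show "ennreal ?c * ennreal (indicator {0..} t * t powr (a - 1)) * ?g t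
       = ennreal (2 powr (p / 2) / Gamma a) * ennreal (indicator {0..} t * t powr (a + p / 2 - 1) / exp t)"
    proof (cases "t \<ge> 0")
      case True
      have "sqrt (2 * t) powr p = 2 powr (p / 2) * t powr (p / 2)"
        using True by (simp add: powr_half_sqrt[symmetric] powr_powr powr_mult)
      moreover have "t powr (a + p / 2 - 1) = t powr (a - 1) * t powr (p / 2)"
        by (simp add: powr_add[symmetric] algebra_simps)
      ultimately show ?thesis
        using a True
        by (simp add: ennreal_mult[symmetric] Gamma_real_pos less_imp_le powr_minus exp_minus field_simps)
    qed simp
  qed
  also have "\<dots> = ennreal (2 powr (p / 2) / Gamma a) * ennreal (Gamma (a + p / 2))"
    using a p by (simp add: nn_integral_cmult Gamma_conv_nn_integral_real)
  also have "\<dots> = ennreal (2 powr (p / 2) * Gamma ((real (card I) + p) / 2) / Gamma (real (card I) / 2))"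
    using a p by (subst ennreal_mult[symmetric])
      (auto simp: Gamma_real_pos less_imp_le a_def add_divide_distrib)
  finally show ?thesis .
qed

section \<open>Gram-Schmidt residuals and Gram determinants\<close>

text \<open>
  \<open>gs_res n G x\<close> is the component of \<open>x\<close> orthogonal to \<open>G 0, \<dots>, G (n - 1)\<close>. If a residual
  vanishes, the junk value of division by zero makes its projection step the identity, which is correct.
\<close>
fun gs_res :: "nat \<Rightarrow> (nat \<Rightarrow> 'a::real_inner) \<Rightarrow> 'a \<Rightarrow> 'a" where
  "gs_res 0 G x = x"
| "gs_res (Suc n) G x = gs_res n G x
     - ((gs_res n G x \<bullet> gs_res n G (G n)) / (gs_res n G (G n) \<bullet> gs_res n G (G n))) *\<^sub>R gs_res n G (G n)"

lemma gs_res_cong: "(\<And>i. i < n \<Longrightarrow> G i = H i) \<Longrightarrow> gs_res n G x = gs_res n H x"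
  by (induction n arbitrary: x) auto

lemma gs_res_orthogonal: "i < n \<Longrightarrow> gs_res n G x \<bullet> gs_res i G (G i) = 0"
proof (induction n arbitrary: x)
  case (Suc n)
  show ?case
  proof (cases "i = n")
    case True
    thus ?thesis by (cases "gs_res n G (G n) = 0") (auto simp: inner_diff_left)
  next
    case False
    thus ?thesis using Suc by (simp add: inner_diff_left)
  qed
qed simp

lemma gs_vec_orthogonal: "i \<noteq> j \<Longrightarrow> gs_res i G (G i) \<bullet> gs_res j G (G j) = 0"
  by (metis gs_res_orthogonal inner_commute linorder_neqE_nat)

text \<open>The recursion projects the current residual, whereas here all coefficients are taken
  from \<open>x\<close> itself. Both agree because the directions already subtracted are orthogonal
  to the next one. This form exhibits the change from the vectors to their residuals as
  triangular.\<close>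

lemma gs_res_eq:
  "gs_res n G x = x - (\<Sum>i<n. ((x \<bullet> gs_res i G (G i)) / (gs_res i G (G i) \<bullet> gs_res i G (G i))) *\<^sub>R gs_res i G (G i))"
proof (induction n)
  case (Suc n)
  have "gs_res n G x \<bullet> gs_res n G (G n) = x \<bullet> gs_res n G (G n)"
    by (subst Suc.IH) (auto simp: inner_diff_left inner_sum_left gs_vec_orthogonal)
  hence "gs_res (Suc n) G x = gs_res n G x
      - ((x \<bullet> gs_res n G (G n)) / (gs_res n G (G n) \<bullet> gs_res n G (G n))) *\<^sub>R gs_res n G (G n)"
    by simp
  also have "gs_res n G x = x - (\<Sum>i<n. ((x \<bullet> gs_res i G (G i)) / (gs_res i G (G i) \<bullet> gs_res i G (G i))) *\<^sub>R gs_res i G (G i))"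
    by (rule Suc.IH)
  finally show ?case by (simp add: algebra_simps)
qed simp

lemma borel_measurable_gs_res [measurable]:
  fixes G :: "'b \<Rightarrow> nat \<Rightarrow> 'a::euclidean_space"
  assumes "\<And>i. i < n \<Longrightarrow> (\<lambda>w. G w i) \<in> borel_measurable M" "X \<in> borel_measurable M"
  shows "(\<lambda>w. gs_res n (G w) (X w)) \<in> borel_measurable M"
  using assms
proof (induction n arbitrary: X)
  case (Suc n)
  have [measurable]: "(\<lambda>w. gs_res n (G w) (X w)) \<in> borel_measurable M"
    "(\<lambda>w. gs_res n (G w) (G w n)) \<in> borel_measurable M"
    using Suc by auto
  show ?case by simp
qed simp

text \<open>The squared volume of the parallelepiped spanned by the \<open>V i\<close>, in an
  ambient space of any dimension.\<close>

definition gram :: "('n::finite \<Rightarrow> 'a::real_inner) \<Rightarrow> real" where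
  "gram V = det (\<chi> i j. V i \<bullet> V j)"

text \<open>The Gram matrix G turns into B G B^T. Three kinds of \<open>B\<close> occur later:
  unitriangular for Gram-Schmidt, diagonal for scaling, orthogonal for rotating the rows.\<close>

lemma gram_linear:
  fixes B :: "real^'n^'n::finite"
  shows "gram (\<lambda>i. \<Sum>j\<in>UNIV. B $ i $ j *\<^sub>R V j) = (det B)\<^sup>2 * gram V"
proof -
  have "(\<chi> i j. (\<Sum>k\<in>UNIV. B $ i $ k *\<^sub>R V k) \<bullet> (\<Sum>k\<in>UNIV. B $ j $ k *\<^sub>R V k))
      = B ** (\<chi> i j. V i \<bullet> V j) ** transpose B"
    by (simp add: vec_eq_iff matrix_matrix_mult_def transpose_def inner_sum_left inner_sum_right
        sum_distrib_left sum_distrib_right mult_ac)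
  thus ?thesis
    by (simp add: gram_def det_mul power2_eq_square mult_ac)
qed

text \<open>Links matrix indices to the natural numbers along which Gram-Schmidt proceeds.
  Monotonicity of this numbering is what makes the coefficient matrix triangular.\<close>

definition order_rank :: "'m::{finite,wellorder} \<Rightarrow> nat" where
  "order_rank i = card {..<i}"

lemma order_rank_less_iff: "order_rank i < order_rank j \<longleftrightarrow> i < j"
proof -
  have *: "order_rank i < order_rank j" if "i < j" for i j :: 'a
    unfolding order_rank_def using that by (intro psubset_card_mono) auto
  show ?thesis
    using *[of i j] *[of j i] by (cases i j rule: linorder_cases) auto
qed

lemma bij_betw_order_rank: "bij_betw (order_rank :: 'm::{finite,wellorder} \<Rightarrow> nat) UNIV {..<CARD('m)}"
proof -
  have "inj (order_rank :: 'm \<Rightarrow> nat)"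
    by (rule injI) (metis order_rank_less_iff less_irrefl linorder_cases)
  moreover have "range (order_rank :: 'm \<Rightarrow> nat) \<subseteq> {..<CARD('m)}"
    by (auto simp: order_rank_def intro!: psubset_card_mono)
  ultimately show ?thesis
    by (simp add: bij_betw_def card_image card_subset_eq)
qed

text \<open>The vectors arise from their residuals by a unitriangular matrix, so both families have
  the same Gram determinant. The residuals are mutually orthogonal, hence theirs is the determinant
  of a diagonal matrix.\<close>

lemma gram_eq_prod_gs_res:
  fixes G :: "nat \<Rightarrow> 'a::real_inner"
  shows "gram (\<lambda>i::'m::{finite,wellorder}. G (order_rank i)) = (\<Prod>k<CARD('m). norm (gs_res k G (G k)))\<^sup>2"
proof -
  define u where "u k = gs_res k G (G k)" for k
  define B :: "((real, 'm) vec, 'm) vec" where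
    "B = (\<chi> i j. if j < i then (G (order_rank i) \<bullet> u (order_rank j)) / (u (order_rank j) \<bullet> u (order_rank j)) else if i = j then 1 else 0)"
  have "G (order_rank i) = (\<Sum>j\<in>UNIV. B $ i $ j *\<^sub>R u (order_rank j))" for i :: 'm
  proof -
    have bij: "bij_betw order_rank {..<i} {..<order_rank i}"
    proof (rule bij_betw_imageI)
      show "inj_on order_rank {..<i}"
        using bij_betw_order_rank by (metis bij_betw_def inj_on_subset subset_UNIV)
      have "k \<in> order_rank ` {..<i}" if "k < order_rank i" for k
      proof -
        have "k < CARD('m)"
          using that bij_betw_order_rank[where 'm='m] by (meson bij_betwE UNIV_I lessThan_iff less_trans)
        then obtain j :: 'm where "k = order_rank j"
          using bij_betw_order_rank[where 'm='m] by (auto simp: bij_betw_def image_iff set_eq_iff)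
        thus ?thesis using that by (auto simp: order_rank_less_iff)
      qed
      thus "order_rank ` {..<i} = {..<order_rank i}" by (auto simp: order_rank_less_iff)
    qed
    have "(\<Sum>j\<in>UNIV. B $ i $ j *\<^sub>R u (order_rank j)) = (\<Sum>j\<in>insert i {..<i}. B $ i $ j *\<^sub>R u (order_rank j))"
      by (intro sum.mono_neutral_right) (auto simp: B_def)
    also have "\<dots> = u (order_rank i) + (\<Sum>j<i. ((G (order_rank i) \<bullet> u (order_rank j)) / (u (order_rank j) \<bullet> u (order_rank j))) *\<^sub>R u (order_rank j))"
      by (simp add: B_def)
    also have "(\<Sum>j<i. ((G (order_rank i) \<bullet> u (order_rank j)) / (u (order_rank j) \<bullet> u (order_rank j))) *\<^sub>R u (order_rank j))
        = (\<Sum>k<order_rank i. ((G (order_rank i) \<bullet> u k) / (u k \<bullet> u k)) *\<^sub>R u k)"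
      by (rule sum.reindex_bij_betw[OF bij])
    also have "u (order_rank i) + \<dots> = G (order_rank i)"
      unfolding u_def by (subst gs_res_eq) simp
    finally show ?thesis ..
  qed
  hence "gram (\<lambda>i::'m. G (order_rank i)) = (det B)\<^sup>2 * gram (\<lambda>j::'m. u (order_rank j))"
    by (simp add: gram_linear)
  also have "det B = 1"
    by (subst det_lowerdiagonal) (auto simp: B_def)
  also have "gram (\<lambda>j::'m. u (order_rank j)) = (\<Prod>j\<in>(UNIV::'m set). u (order_rank j) \<bullet> u (order_rank j))"
    unfolding gram_def
    by (subst det_diagonal) (auto simp: u_def intro!: gs_vec_orthogonal dest: order_rank_less_iff[THEN iffD2] elim!: linorder_neqE)
  also have "\<dots> = (\<Prod>k<CARD('m). u k \<bullet> u k)"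
    by (rule prod.reindex_bij_betw[OF bij_betw_order_rank])
  finally show ?thesis
    by (simp add: u_def power2_norm_eq_inner prod_power_distrib)
qed

section \<open>Moments of the lengths of Gram-Schmidt residuals\<close>

lemma nn_integral_gauss_coords:
  fixes B :: "'a::euclidean_space set"
  assumes B: "B \<subseteq> Basis" "B \<noteq> {}" and p: "p > 0"
  shows "(\<integral>\<^sup>+x. ennreal (sqrt (\<Sum>b\<in>B. (x \<bullet> b)\<^sup>2) powr p) \<partial>gauss)
    = ennreal (2 powr (p / 2) * Gamma ((real (card B) + p) / 2) / Gamma (real (card B) / 2))"
proof -
  have fin: "finite B" using B(1) by (rule finite_subset) simp
  interpret product_prob_space "\<lambda>_::'a. std_normal" Basis
    using prob_space_normal_density[of 1 0]
    by (simp add: product_prob_space_def product_sigma_finite_def product_prob_space_axioms_def prob_space_imp_sigma_finite)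
  have "(\<integral>\<^sup>+x. ennreal (sqrt (\<Sum>b\<in>B. (x \<bullet> b)\<^sup>2) powr p) \<partial>gauss)
      = (\<integral>\<^sup>+f. ennreal (sqrt (\<Sum>b\<in>B. ((\<Sum>c\<in>Basis. f c *\<^sub>R c) \<bullet> b)\<^sup>2) powr p) \<partial>PiM Basis (\<lambda>_. std_normal))"
    unfolding gauss_eq_distr_PiM by (subst nn_integral_distr) auto
  also have "\<dots> = (\<integral>\<^sup>+f. ennreal (sqrt (\<Sum>b\<in>B. (restrict f B b)\<^sup>2) powr p) \<partial>PiM Basis (\<lambda>_. std_normal))"
    using B by (intro nn_integral_cong) (auto simp: subset_iff intro!: arg_cong[where f = "\<lambda>x. x powr p"] sum.cong)
  also have "\<dots> = (\<integral>\<^sup>+f. ennreal (sqrt (\<Sum>b\<in>B. (f b)\<^sup>2) powr p)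
      \<partial>distr (PiM Basis (\<lambda>_. std_normal)) (PiM B (\<lambda>_. std_normal)) (\<lambda>f. restrict f B))"
    using B by (intro nn_integral_distr[symmetric] measurable_restrict_subset) measurable
  \<comment> \<open>The coordinates outside \<open>B\<close> integrate out: a product of probability
    measures restricts to the product over a subset.\<close>
  also have "distr (PiM Basis (\<lambda>_. std_normal)) (PiM B (\<lambda>_. std_normal)) (\<lambda>f. restrict f B) = PiM B (\<lambda>_. std_normal)"
    using distr_restrict[of B Basis] B by simp
  also have "(\<integral>\<^sup>+f. ennreal (sqrt (\<Sum>b\<in>B. (f b)\<^sup>2) powr p) \<partial>PiM B (\<lambda>_. std_normal))
    = ennreal (2 powr (p / 2) * Gamma ((real (card B) + p) / 2) / Gamma (real (card B) / 2))"
    using fin B p by (intro nn_integral_sum_squares_powr)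
  finally show ?thesis .
qed

text \<open>The nonzero residuals are \<open>n\<close> orthogonal directions \<open>U\<close>, which
  extend to an orthogonal basis \<open>U \<union> W\<close>. Taking the residual deletes the
  \<open>U\<close>-part, so a rotation onto the standard basis turns its length into that of
  \<open>DIM('a) - n\<close> standard coordinates.\<close>

lemma nn_integral_norm_gs_res:
  fixes G :: "nat \<Rightarrow> 'a::euclidean_space"
  assumes nz: "\<And>i. i < n \<Longrightarrow> gs_res i G (G i) \<noteq> 0" and n: "n < DIM('a)" and p: "p > 0"
  shows "(\<integral>\<^sup>+x. ennreal (norm (gs_res n G x) powr p) \<partial>gauss)
    = ennreal (2 powr (p / 2) * Gamma ((real (DIM('a) - n) + p) / 2) / Gamma (real (DIM('a) - n) / 2))"
proof -
  define u where "u i = gs_res i G (G i)" for i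
  define U where "U = u ` {..<n}"
  have inj: "inj_on u {..<n}"
  proof (rule inj_onI, rule ccontr)
    fix i j assume *: "i \<in> {..<n}" "u i = u j" "i \<noteq> j"
    have "u i \<bullet> u j = 0"
      unfolding u_def using *(3) by (rule gs_vec_orthogonal)
    thus False using * nz[of i] by (simp add: u_def)
  qed
  have U: "card U = n" "finite U" "0 \<notin> U"
    using inj nz by (simp_all add: U_def card_image) (auto simp: u_def)
  have "pairwise orthogonal U"
    unfolding U_def u_def by (auto simp: pairwise_def orthogonal_def intro!: gs_vec_orthogonal)
  then obtain W where W: "W \<inter> insert 0 U = {}" "pairwise orthogonal (U \<union> W)" "span (U \<union> W) = span (U \<union> UNIV)"
    by (rule orthogonal_extension_strong)
  define C where "C = U \<union> W"
  have C: "pairwise orthogonal C" "span C = UNIV" "0 \<notin> C"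
    using W U by (auto simp: C_def)
  have ind: "independent C"
    using C by (intro pairwise_orthogonal_independent)
  hence finC: "finite C" by (rule independent_imp_finite)
  have cardC: "card C = DIM('a)"
    using C(2) ind by (metis dim_UNIV dim_eq_card_independent dim_span)
  have expand: "(\<Sum>c\<in>C. ((x \<bullet> c) / (c \<bullet> c)) *\<^sub>R c) = x" for x
  proof (rule vector_eq_dot_span)
    fix d assume d: "d \<in> C"
    have "d \<bullet> (\<Sum>c\<in>C. ((x \<bullet> c) / (c \<bullet> c)) *\<^sub>R c) = (\<Sum>c\<in>C. if c = d then d \<bullet> x else 0)"
      unfolding inner_sum_right using C d
      by (intro sum.cong) (auto simp: pairwise_def orthogonal_def inner_commute)
    thus "d \<bullet> (\<Sum>c\<in>C. ((x \<bullet> c) / (c \<bullet> c)) *\<^sub>R c) = d \<bullet> x"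
      using finC d by simp
  qed (auto simp: C)
  obtain \<phi> where \<phi>: "bij_betw \<phi> C (Basis :: 'a set)"
    using finC cardC by (metis finite_same_card_bij finite_Basis)
  hence inj\<phi>: "inj_on \<phi> C" and \<phi>C: "\<phi> ` C = Basis" by (auto simp: bij_betw_def)
  \<comment> \<open>\<open>T\<close> sends each unit vector \<open>c / norm c\<close> to
    \<open>\<phi> c\<close>; the basis \<open>C\<close> is orthogonal but not normalized.\<close>
  define T where "T x = (\<Sum>c\<in>C. ((x \<bullet> c) / norm c) *\<^sub>R \<phi> c)" for x
  have lin: "linear T"
    unfolding T_def by (intro linear_compose_sum ballI linearI) (auto simp: algebra_simps add_divide_distrib)
  have inner: "T x \<bullet> \<phi> c = (x \<bullet> c) / norm c" if "c \<in> C" for x c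
  proof -
    have "T x \<bullet> \<phi> c = (\<Sum>d\<in>C. if d = c then (x \<bullet> c) / norm c else 0)"
      unfolding T_def inner_sum_left using \<phi>C that C(3)
      by (intro sum.cong) (auto simp: inner_Basis inj_on_eq_iff[OF inj\<phi>] bij_betwE[OF \<phi>])
    thus ?thesis using finC that by simp
  qed
  have normT: "norm (T x) = norm x" for x
  proof -
    have "T x \<bullet> T x = (\<Sum>b\<in>Basis. (T x \<bullet> b) * (T x \<bullet> b))"
      by (rule euclidean_inner)
    also have "\<dots> = (\<Sum>c\<in>C. (T x \<bullet> \<phi> c) * (T x \<bullet> \<phi> c))"
      by (rule sum.reindex_bij_betw[OF \<phi>, symmetric])
    also have "\<dots> = (\<Sum>c\<in>C. ((x \<bullet> c) / (c \<bullet> c)) *\<^sub>R c) \<bullet> x"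
      unfolding inner_sum_left
      by (intro sum.cong) (auto simp: inner dot_square_norm power2_eq_square inner_commute)
    also have "\<dots> = x \<bullet> x" by (simp only: expand)
    finally show ?thesis by (simp add: norm_eq_sqrt_inner)
  qed
  have [measurable]: "T \<in> borel_measurable borel"
    by (intro borel_measurable_continuous_onI linear_continuous_on linear_conv_bounded_linear[THEN iffD1] lin)
  have WC: "W \<subseteq> C" "finite W" and UW: "U \<inter> W = {}"
    using finC W by (auto simp: C_def)
  have "card W = DIM('a) - n"
    using cardC U WC UW card_Un_disjoint[of U W] by (simp add: C_def)
  hence card: "card (\<phi> ` W) = DIM('a) - n"
    using card_image inj_on_subset[OF inj\<phi> WC(1)] by metis
  have norm: "norm (gs_res n G x) = sqrt (\<Sum>b\<in>\<phi> ` W. (T x \<bullet> b)\<^sup>2)" for x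
  proof -
    have "gs_res n G x = x - (\<Sum>i<n. ((x \<bullet> u i) / (u i \<bullet> u i)) *\<^sub>R u i)"
      unfolding u_def by (rule gs_res_eq)
    also have "(\<Sum>i<n. ((x \<bullet> u i) / (u i \<bullet> u i)) *\<^sub>R u i) = (\<Sum>c\<in>U. ((x \<bullet> c) / (c \<bullet> c)) *\<^sub>R c)"
      unfolding U_def by (simp add: sum.reindex[OF inj])
    also have "x - \<dots> = (\<Sum>c\<in>W. ((x \<bullet> c) / (c \<bullet> c)) *\<^sub>R c)"
      using expand[of x] U WC UW unfolding C_def by (simp add: sum.union_disjoint diff_eq_eq add.commute)
    finally have "gs_res n G x = (\<Sum>c\<in>W. ((x \<bullet> c) / (c \<bullet> c)) *\<^sub>R c)" .
    hence "(norm (gs_res n G x))\<^sup>2 = (\<Sum>c\<in>W. (norm (((x \<bullet> c) / (c \<bullet> c)) *\<^sub>R c))\<^sup>2)"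
      using WC C by (simp only:) (intro norm_sum_Pythagorean; auto simp: pairwise_def orthogonal_def)
    also have "\<dots> = (\<Sum>c\<in>W. (T x \<bullet> \<phi> c)\<^sup>2)"
      using WC C by (intro sum.cong) (auto simp: inner subset_iff dot_square_norm power_divide power_mult_distrib power2_eq_square)
    also have "\<dots> = (\<Sum>b\<in>\<phi> ` W. (T x \<bullet> b)\<^sup>2)"
      using inj_on_subset[OF inj\<phi> WC(1)] by (simp add: sum.reindex)
    finally show ?thesis by (metis norm_ge_zero real_sqrt_unique)
  qed
  have "(\<integral>\<^sup>+x. ennreal (norm (gs_res n G x) powr p) \<partial>gauss)
      = (\<integral>\<^sup>+x. ennreal (sqrt (\<Sum>b\<in>\<phi> ` W. (x \<bullet> b)\<^sup>2) powr p) \<partial>distr gauss borel T)"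
    by (subst nn_integral_distr) (auto simp: norm)
  also have "distr gauss borel T = gauss"
    using lin normT by (rule gauss_distr_isometry) simp
  also have "(\<integral>\<^sup>+x. ennreal (sqrt (\<Sum>b\<in>\<phi> ` W. (x \<bullet> b)\<^sup>2) powr p) \<partial>gauss)
      = ennreal (2 powr (p / 2) * Gamma ((real (DIM('a) - n) + p) / 2) / Gamma (real (DIM('a) - n) / 2))"
    unfolding card[symmetric] using WC \<phi>C p card n by (intro nn_integral_gauss_coords) auto
  finally show ?thesis .
qed

text \<open>The last vector is integrated innermost. With the earlier vectors fixed, the moment of
  its residual is a constant independent of them, so it comes out as a factor.\<close>

lemma nn_integral_prod_gs_res:
  assumes p: "p > 0" and n: "n \<le> DIM('a::euclidean_space)"
  shows "(\<integral>\<^sup>+G. ennreal ((\<Prod>k<n. norm (gs_res k G (G k))) powr p) \<partial>PiM {..<n} (\<lambda>_. gauss :: 'a measure))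
    = ennreal (\<Prod>k<n. 2 powr (p / 2) * Gamma ((real (DIM('a) - k) + p) / 2) / Gamma (real (DIM('a) - k) / 2))"
    (is "_ = ennreal (\<Prod>k<n. ?K k)")
  using n
proof (induction n)
  case 0
  thus ?case by (simp add: PiM_empty nn_integral_count_space_finite)
next
  case (Suc n)
  interpret product_sigma_finite "\<lambda>_::nat. gauss :: 'a measure"
    by (simp add: product_sigma_finite_def prob_space_gauss prob_space_imp_sigma_finite)
  have eq: "ennreal ((\<Prod>k<Suc n. norm (gs_res k (G(n := x)) ((G(n := x)) k))) powr p)
      = ennreal ((\<Prod>k<n. norm (gs_res k G (G k))) powr p) * ennreal (norm (gs_res n G x) powr p)"
    for G :: "nat \<Rightarrow> 'a" and x
  proof -
    \<comment> \<open>Residuals of order at most \<open>n\<close> look only at positions below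
      \<open>n\<close>, so an update at \<open>n\<close> leaves them alone.\<close>
    have "gs_res k (G(n := x)) y = gs_res k G y" if "k \<le> n" for k y
      using that by (intro gs_res_cong) auto
    thus ?thesis
      by (simp add: powr_mult prod_nonneg ennreal_mult)
  qed
  have K: "?K k \<ge> 0" if "k < DIM('a)" for k
    using that p by (intro divide_nonneg_nonneg mult_nonneg_nonneg less_imp_le[OF Gamma_real_pos]) auto
  have "(\<integral>\<^sup>+G. ennreal ((\<Prod>k<Suc n. norm (gs_res k G (G k))) powr p) \<partial>PiM {..<Suc n} (\<lambda>_. gauss :: 'a measure))
     = (\<integral>\<^sup>+G. (\<integral>\<^sup>+x. ennreal ((\<Prod>k<Suc n. norm (gs_res k (G(n := x)) ((G(n := x)) k))) powr p) \<partial>gauss) \<partial>PiM {..<n} (\<lambda>_. gauss :: 'a measure))"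
    unfolding lessThan_Suc by (intro product_nn_integral_insert) auto
  also have "\<dots> = (\<integral>\<^sup>+G. ennreal (?K n) * ennreal ((\<Prod>k<n. norm (gs_res k G (G k))) powr p) \<partial>PiM {..<n} (\<lambda>_. gauss :: 'a measure))"
  proof (intro nn_integral_cong, unfold eq)
    fix G :: "nat \<Rightarrow> 'a"
    show "(\<integral>\<^sup>+x. ennreal ((\<Prod>k<n. norm (gs_res k G (G k))) powr p) * ennreal (norm (gs_res n G x) powr p) \<partial>gauss)
      = ennreal (?K n) * ennreal ((\<Prod>k<n. norm (gs_res k G (G k))) powr p)"
    \<comment> \<open>If an earlier residual vanishes, both sides are 0. Degenerate configurations
      are thus settled pointwise, without showing that they form a null set.\<close>
    proof (cases "\<exists>k<n. gs_res k G (G k) = 0")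
      case True
      hence zero: "(\<Prod>k<n. norm (gs_res k G (G k))) = 0" by auto
      show ?thesis unfolding zero by simp
    next
      case False
      thus ?thesis
        using Suc.prems p by (subst nn_integral_cmult) (auto simp: nn_integral_norm_gs_res mult.commute)
    qed
  qed
  also have "\<dots> = ennreal (?K n) * ennreal (\<Prod>k<n. ?K k)"
    using Suc by (subst nn_integral_cmult) auto
  also have "\<dots> = ennreal (\<Prod>k<Suc n. ?K k)"
    using K Suc.prems by (subst ennreal_mult[symmetric]) (auto intro!: prod_nonneg simp: mult.commute)
  finally show ?case .
qed

section \<open>Gaussian measures on products\<close>

text \<open>Allows a rotation that mixes two independent Gaussian blocks to be treated as an
  isometry of one Gaussian vector.\<close>

lemma gauss_pair: "(gauss :: 'a::euclidean_space measure) \<Otimes>\<^sub>M (gauss :: 'b::euclidean_space measure) = gauss"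
proof -
  have "(gauss :: 'a measure) \<Otimes>\<^sub>M (gauss :: 'b measure)
    = density (lborel \<Otimes>\<^sub>M lborel) (\<lambda>(x, y). ennreal ((2 * pi) powr (- real DIM('a) / 2) * exp (- (norm x)\<^sup>2 / 2))
        * ennreal ((2 * pi) powr (- real DIM('b) / 2) * exp (- (norm y)\<^sup>2 / 2)))"
    unfolding gauss_def
    using prob_space_gauss[where 'a='b]
    by (intro pair_measure_density sigma_finite_lborel)
       (auto simp: gauss_def intro: prob_space_imp_sigma_finite)
  also have "\<dots> = (gauss :: ('a \<times> 'b) measure)"
    unfolding gauss_def lborel_prod
  proof (intro arg_cong[where f = "density lborel"] ext, clarsimp)
    fix x :: 'a and y :: 'b
    have "(2 * pi) powr (- real DIM('a) / 2) * exp (- (norm x)\<^sup>2 / 2)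
        * ((2 * pi) powr (- real DIM('b) / 2) * exp (- (norm y)\<^sup>2 / 2))
      = (2 * pi) powr (- real DIM('a) / 2 + - real DIM('b) / 2) * exp (- (norm x)\<^sup>2 / 2 + - (norm y)\<^sup>2 / 2)"
      by (simp only: powr_add exp_add mult_ac)
    also have "- real DIM('a) / 2 + - real DIM('b) / 2 = (- real DIM('a) - real DIM('b)) / 2"
      by (simp add: field_simps)
    also have "- (norm x)\<^sup>2 / 2 + - (norm y)\<^sup>2 / 2 = - (norm (x, y))\<^sup>2 / 2"
      by (simp add: norm_Pair field_simps)
    finally show "ennreal ((2 * pi) powr (- (real DIM('a) / 2)) * exp (- ((norm x)\<^sup>2 / 2)))
        * ennreal ((2 * pi) powr (- (real DIM('b) / 2)) * exp (- ((norm y)\<^sup>2 / 2)))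
      = ennreal ((2 * pi) powr ((- real DIM('a) - real DIM('b)) / 2) * exp (- ((norm (x, y))\<^sup>2 / 2)))"
      by (simp add: ennreal_mult[symmetric])
  qed
  finally show ?thesis .
qed

lemma prod_Basis_vec:
  "(\<Prod>b\<in>(Basis :: ('a::euclidean_space^'n) set). f b) = (\<Prod>i\<in>UNIV. \<Prod>b\<in>Basis. f (axis i b))"
proof -
  have "bij_betw (\<lambda>(i, b). axis i b) (UNIV \<times> Basis) (Basis :: ('a^'n) set)"
    by (rule bij_betw_imageI) (auto simp: inj_on_def Basis_vec_def axis_eq_axis nonzero_Basis)
  hence "(\<Prod>b\<in>(Basis :: ('a^'n) set). f b) = (\<Prod>z\<in>UNIV \<times> Basis. f (case z of (i, b) \<Rightarrow> axis i b))"
    by (intro prod.reindex_bij_betw[symmetric])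
  thus ?thesis
    by (simp add: prod.cartesian_product case_prod_unfold)
qed

lemma borel_measurable_vec_lambda [measurable (raw)]:
  fixes f :: "'b \<Rightarrow> 'n::finite \<Rightarrow> 'a::euclidean_space"
  assumes "\<And>i. (\<lambda>x. f x i) \<in> borel_measurable M"
  shows "(\<lambda>x. \<chi> i. f x i) \<in> borel_measurable M"
proof (rule borel_measurable_euclidean_space[THEN iffD2], rule ballI)
  fix b :: "'a^'n" assume "b \<in> Basis"
  then obtain i c where b: "b = axis i c" "c \<in> Basis" by (auto simp: Basis_vec_def)
  show "(\<lambda>x. (\<chi> i. f x i) \<bullet> b) \<in> borel_measurable M"
    using assms by (simp add: b inner_axis)
qed

lemma borel_measurable_vec_nth [measurable (raw)]:
  fixes f :: "'b \<Rightarrow> 'a::euclidean_space^'n"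
  assumes "f \<in> borel_measurable M"
  shows "(\<lambda>x. f x $ i) \<in> borel_measurable M"
  by (intro borel_measurable_continuous_on[OF _ assms] continuous_intros)

text \<open>A box in \<open>'a^'n\<close> is a product of boxes in \<open>'a\<close>, and boxes
  determine Lebesgue measure.\<close>

lemma lborel_vec:
  "distr (PiM UNIV (\<lambda>_. lborel)) borel (\<lambda>f. \<chi> i. f i) = (lborel :: ('a::euclidean_space^'n::finite) measure)"
proof (rule lborel_eqI[symmetric])
  interpret product_sigma_finite "\<lambda>_::'n. lborel :: 'a measure" by standard
  fix l u :: "'a^'n" assume lu: "\<And>b. b \<in> Basis \<Longrightarrow> l \<bullet> b \<le> u \<bullet> b"
  have lu': "l $ i \<bullet> b \<le> u $ i \<bullet> b" if "b \<in> Basis" for i b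
    using lu[of "axis i b"] that by (auto simp: inner_axis)
  have vimage: "(\<lambda>f. \<chi> i. f i) -` box l u \<inter> space (PiM UNIV (\<lambda>_. lborel)) = (\<Pi>\<^sub>E i\<in>UNIV. box (l $ i) (u $ i))"
    by (auto simp: space_PiM PiE_def Pi_iff mem_box Basis_vec_def inner_axis)
  have "emeasure (distr (PiM UNIV (\<lambda>_. lborel)) borel (\<lambda>f. \<chi> i. f i)) (box l u)
    = (\<Prod>i\<in>UNIV. emeasure lborel (box (l $ i) (u $ i)))"
    by (subst emeasure_distr) (auto simp: vimage emeasure_PiM)
  also have "\<dots> = (\<Prod>i\<in>UNIV. ennreal (\<Prod>b\<in>Basis. (u - l) $ i \<bullet> b))"
    using lu' by (intro prod.cong refl) (subst emeasure_lborel_box, auto simp: inner_diff_left)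
  also have "\<dots> = ennreal (\<Prod>i\<in>UNIV. \<Prod>b\<in>Basis. (u - l) $ i \<bullet> b)"
    using lu' by (intro prod_ennreal prod_nonneg) (auto simp: inner_diff_left)
  also have "(\<Prod>i\<in>UNIV. \<Prod>b\<in>Basis. (u - l) $ i \<bullet> b) = (\<Prod>b\<in>Basis. (u - l) \<bullet> b)"
    by (simp add: prod_Basis_vec inner_axis)
  finally show "emeasure (distr (PiM UNIV (\<lambda>_. lborel)) borel (\<lambda>f. \<chi> i. f i)) (box l u) = ennreal (\<Prod>b\<in>Basis. (u - l) \<bullet> b)" .
qed simp

lemma gauss_vec:
  "distr (PiM UNIV (\<lambda>_. gauss)) borel (\<lambda>f. \<chi> i. f i) = (gauss :: ('a::euclidean_space^'n::finite) measure)"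
proof -
  let ?c = "\<lambda>d. (2 * pi) powr (- real d / 2)"
  have dens: "ennreal (?c DIM('a^'n) * exp (- (norm (\<chi> i. (f i :: 'a)))\<^sup>2 / 2))
      = (\<Prod>i\<in>UNIV. ennreal (?c DIM('a) * exp (- (norm (f i))\<^sup>2 / 2)))" for f :: "'n \<Rightarrow> 'a"
  proof -
    have "(norm (\<chi> i. f i))\<^sup>2 = (\<Sum>i\<in>UNIV. (norm (f i))\<^sup>2)"
      by (simp add: norm_vec_def L2_set_def sum_nonneg)
    hence "exp (- (norm (\<chi> i. f i))\<^sup>2 / 2) = (\<Prod>i\<in>UNIV. exp (- (norm (f i))\<^sup>2 / 2))"
      by (simp add: exp_sum[symmetric] sum_negf sum_divide_distrib)
    moreover have "?c DIM('a^'n) = ?c DIM('a) ^ CARD('n)"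
      by (simp add: powr_realpow[symmetric] powr_powr mult_ac)
    ultimately show ?thesis
      by (simp add: prod_ennreal prod.distrib)
  qed
  have "(gauss :: ('a^'n) measure) = distr (density (PiM UNIV (\<lambda>_. lborel))
      (\<lambda>f. ennreal (?c DIM('a^'n) * exp (- (norm (\<chi> i. (f i :: 'a)))\<^sup>2 / 2)))) borel (\<lambda>f. \<chi> i. f i)"
    unfolding gauss_def by (subst lborel_vec[symmetric], subst density_distr) auto
  also have "density (PiM UNIV (\<lambda>_. lborel))
      (\<lambda>f :: 'n \<Rightarrow> 'a. ennreal (?c DIM('a^'n) * exp (- (norm (\<chi> i. (f i :: 'a)))\<^sup>2 / 2))) = PiM UNIV (\<lambda>_. gauss)"
    unfolding dens gauss_def
    using prob_space_gauss[where 'a='a]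
    by (intro PiM_density sigma_finite_lborel) (auto simp: gauss_def intro: prob_space_imp_sigma_finite)
  finally show ?thesis ..
qed

text \<open>Connects the two ways of indexing: families numbered by naturals, as in Gram-Schmidt and
  in the theorem, and the rows of one large vector, on which rotations act.\<close>

lemma gauss_vec_reindex:
  fixes e :: "'n::finite \<Rightarrow> 'i"
  assumes e: "bij_betw e UNIV I"
  shows "distr (PiM I (\<lambda>_. gauss)) borel (\<lambda>G. \<chi> i. G (e i)) = (gauss :: ('a::euclidean_space^'n) measure)"
proof -
  have "(\<lambda>G. \<lambda>i\<in>UNIV. G (e i)) \<in> measurable (PiM I (\<lambda>_. gauss :: 'a measure)) (PiM UNIV (\<lambda>_. gauss))"
    using bij_betwE[OF e] by (intro measurable_restrict) auto
  hence [measurable]: "(\<lambda>G i. G (e i)) \<in> measurable (PiM I (\<lambda>_. gauss :: 'a measure)) (PiM UNIV (\<lambda>_. gauss))"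
    by (simp add: restrict_UNIV)
  have "(gauss :: ('a^'n) measure) = distr (distr (PiM I (\<lambda>_. gauss)) (PiM UNIV (\<lambda>_. gauss)) (\<lambda>G. \<lambda>i\<in>UNIV. G (e i))) borel (\<lambda>f. \<chi> i. f i)"
    using e by (subst distr_PiM_reindex) (auto simp: gauss_vec prob_space_gauss bij_betw_def)
  also have "\<dots> = distr (PiM I (\<lambda>_. gauss)) borel (\<lambda>G. \<chi> i. G (e i))"
    by (subst distr_distr) (auto simp: o_def restrict_UNIV)
  finally show ?thesis ..
qed

section \<open>Volumes of simplices\<close>

text \<open>
  The linear change of variables formula of the library needs a wellordered index type, so the
  index type of \<open>\<real>\<^sup>l\<close> is replaced by a wellordered copy.
\<close>
typedef 'a wo = "UNIV :: 'a set"
  morphisms of_wo to_wo by auto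

instance wo :: (finite) finite
proof
  have "finite (range (to_wo :: 'a \<Rightarrow> 'a wo))" by simp
  also have "range (to_wo :: 'a \<Rightarrow> 'a wo) = UNIV"
    by (metis of_wo_inverse surjI)
  finally show "finite (UNIV :: 'a wo set)" .
qed

instantiation wo :: (finite) wellorder
begin

definition less_eq_wo :: "'a wo \<Rightarrow> 'a wo \<Rightarrow> bool" where
  "less_eq_wo x y \<longleftrightarrow> to_nat (of_wo x) \<le> to_nat (of_wo y)"

definition less_wo :: "'a wo \<Rightarrow> 'a wo \<Rightarrow> bool" where
  "less_wo x y \<longleftrightarrow> to_nat (of_wo x) < to_nat (of_wo y)"

instance
proof
  fix P :: "'a wo \<Rightarrow> bool" and a :: "'a wo"
  assume step: "\<And>x. (\<And>y. y < x \<Longrightarrow> P y) \<Longrightarrow> P x"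
  show "P a"
    by (induction a rule: measure_induct_rule[of "\<lambda>x. to_nat (of_wo x)"]) (auto intro: step simp: less_wo_def)
qed (auto simp: less_eq_wo_def less_wo_def of_wo_inject)

end

lemma bij_of_wo: "bij (of_wo :: 'a wo \<Rightarrow> 'a)"
  by (metis UNIV_I bij_betw_def inj_def of_wo_inject surj_def to_wo_inverse)

lemma card_wo [simp]: "CARD('a wo) = CARD('a)"
  using bij_of_wo by (rule bij_betw_same_card)

text \<open>\<open>vol_l\<close> chooses among all distance-preserving maps, so linearity has to be
  derived. By polarization distances determine inner products, and then the defects of additivity
  and homogeneity have norm 0.\<close>

lemma isometry_linear_part:
  fixes f :: "'a::real_inner \<Rightarrow> 'b::real_inner"
  assumes dist: "\<And>x y. dist (f x) (f y) = dist x y"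
  shows "linear (\<lambda>x. f x - f 0)" and "(f x - f 0) \<bullet> (f y - f 0) = x \<bullet> y"
proof -
  define g where "g x = f x - f 0" for x
  have norm: "norm (g x - g y) = norm (x - y)" for x y
    using dist[of x y] by (simp add: g_def dist_norm)
  have norm0: "norm (g x) = norm x" for x
    using norm[of x 0] by (simp add: g_def)
  have inner: "g x \<bullet> g y = x \<bullet> y" for x y
    by (simp add: dot_norm_neg norm norm0)
  thus "(f x - f 0) \<bullet> (f y - f 0) = x \<bullet> y"
    by (simp add: g_def)
  show "linear (\<lambda>x. f x - f 0)"
  proof (fold g_def, rule linearI)
    fix x y
    have "(g (x + y) - g x - g y) \<bullet> (g (x + y) - g x - g y) = 0"
      by (simp add: inner_diff_left inner_diff_right inner) (simp add: inner_add_left inner_add_right inner_commute)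
    thus "g (x + y) = g x + g y" by (simp add: diff_diff_eq)
  next
    fix c x
    have "(g (c *\<^sub>R x) - c *\<^sub>R g x) \<bullet> (g (c *\<^sub>R x) - c *\<^sub>R g x) = 0"
      by (simp add: inner_diff_left inner_diff_right inner)
    thus "g (c *\<^sub>R x) = c *\<^sub>R g x" by simp
  qed
qed

text \<open>A basis of \<open>S\<close>, which is too small when a simplex is degenerate, is filled
  up to exactly \<open>DIM('a)\<close> independent vectors; subspaces of equal dimension are
  isometric.\<close>

lemma isometric_embedding_exists:
  fixes S :: "'b::euclidean_space set"
  assumes S: "subspace S" "dim S \<le> DIM('a::euclidean_space)" and le: "DIM('a::euclidean_space) \<le> DIM('b)"
  obtains f :: "'a::euclidean_space \<Rightarrow> 'b" where "linear f" "\<And>x. norm (f x) = norm x" "S \<subseteq> range f"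
proof -
  obtain B where B: "B \<subseteq> S" "independent B" "S \<subseteq> span B" "card B = dim S"
    using basis_exists[of S] by metis
  obtain C where C: "B \<subseteq> C" "independent C" "UNIV \<subseteq> span C"
    using maximal_independent_subset_extend[of B UNIV] B by auto
  have finC: "finite C" using C by (simp add: independent_imp_finite)
  have cardC: "card C = DIM('b)"
    using C dim_eq_card[of C UNIV] by (simp add: dim_UNIV span_eq top.extremum_uniqueI)
  obtain D where D: "B \<subseteq> D" "D \<subseteq> C" "card D = DIM('a)"
    using exists_subset_between[of B "DIM('a)" C] B S le cardC C finC by auto
  have "independent D" using C D independent_mono by blast
  hence "dim (span D) = DIM('a)"
    using D by (simp add: dim_eq_card_independent)
  hence "dim (UNIV :: 'a set) = dim (span D)" by (simp add: dim_UNIV)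
  then obtain f :: "'a \<Rightarrow> 'b" where f: "linear f" "f ` UNIV = span D" "\<And>x. x \<in> UNIV \<Longrightarrow> norm (f x) = norm x"
    by (rule isometries_subspaces[OF subspace_UNIV subspace_span]) blast
  show thesis
  proof (rule that[of f])
    show "S \<subseteq> range f" using f B D span_mono[of B D] by auto
  qed (use f in auto)
qed

text \<open>The simplex is a translated image of the standard simplex, of volume
  \<open>1 / fact CARD('m)\<close>, under the matrix \<open>M\<close> whose columns are the edges.
  The Gram matrix is M^T M, so the factor |det M| is the square root of its determinant.\<close>

lemma measure_simplex_gram:
  fixes z :: "'m::{finite,wellorder} \<Rightarrow> (real, 'm) vec"
  shows "measure lebesgue (convex hull (insert z0 (range z))) = sqrt (gram (\<lambda>i. z i - z0)) / fact CARD('m)"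
proof -
  define M :: "((real, 'm) vec, 'm) vec" where "M = (\<chi> i j. z j $ i - z0 $ i)"
  let ?std = "convex hull (insert 0 Basis) :: (real, 'm) vec set"
  have compact: "compact ?std"
    by (intro finite_imp_compact_convex_hull) auto
  have M: "M *v axis j 1 = z j - z0" for j
    by (simp add: M_def matrix_vector_mult_basis column_def vec_eq_iff)
  have "(\<lambda>x. M *v x) ` ?std = convex hull ((\<lambda>x. M *v x) ` insert 0 Basis)"
    by (rule convex_hull_linear_image) simp
  also have "(\<lambda>x. M *v x) ` insert 0 Basis = insert 0 (range (\<lambda>j. z j - z0))"
    by (auto simp: Basis_vec_def image_iff M)
  also have "(+) z0 ` (convex hull \<dots>) = convex hull ((+) z0 ` \<dots>)"
    by (rule convex_hull_translation[symmetric])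
  also have "(+) z0 ` insert 0 (range (\<lambda>j. z j - z0)) = insert z0 (range z)"
    by (simp add: image_image)
  finally have "convex hull (insert z0 (range z)) = (+) z0 ` (\<lambda>x. M *v x) ` ?std" ..
  hence "measure lebesgue (convex hull (insert z0 (range z))) = measure lebesgue ((\<lambda>x. M *v x) ` ?std)"
    by (simp add: measure_translation)
  also have "\<dots> = \<bar>det M\<bar> * measure lebesgue ?std"
    using compact compact_imp_bounded[OF compact]
    by (subst measure_lebesgue_linear_transformation) (auto dest: compact_imp_closed)
  also have "measure lebesgue ?std = measure lborel ?std"
    using compact by (intro measure_completion) (auto dest: compact_imp_closed)
  also have "measure lborel ?std = 1 / fact CARD('m)"
    by (simp add: content_std_simplex)
  also have "gram (\<lambda>i. z i - z0) = (det M)\<^sup>2"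
  proof -
    have "(\<chi> i j. (z i - z0) \<bullet> (z j - z0)) = transpose M ** M"
      by (simp add: vec_eq_iff M_def matrix_matrix_mult_def transpose_def inner_vec_def)
    thus ?thesis by (simp add: gram_def det_mul power2_eq_square)
  qed
  hence "\<bar>det M\<bar> = sqrt (gram (\<lambda>i. z i - z0))" by simp
  finally show ?thesis by simp
qed

text \<open>Of the embedding chosen by \<open>SOME\<close> only the defining property is known, and
  only once some embedding exists, which is where \<open>CARD('l) \<le> CARD('d)\<close> enters.
  Pulling the simplex back along it preserves the inner products of edges, so every choice gives the
  same value.\<close>

lemma vol_l_simplex:
  fixes y :: "'l::finite wo \<Rightarrow> real^'d::finite"
  assumes le: "CARD('l) \<le> CARD('d)"
  shows "vol_l TYPE('l) (convex hull (insert y0 (range y))) = sqrt (gram (\<lambda>i. y i - y0)) / fact CARD('l)"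
proof -
  let ?S = "convex hull (insert y0 (range y))"
  define P where "P f \<longleftrightarrow> (\<forall>x x'. dist (f x) (f x') = dist x x') \<and> ?S \<subseteq> range f" for f :: "real^'l \<Rightarrow> real^'d"
  have "\<exists>f. P f"
  proof -
    have "dim (span (range (\<lambda>i. y i - y0))) \<le> card (range (\<lambda>i. y i - y0))"
      by (simp add: dim_le_card')
    also have "\<dots> \<le> DIM(real^'l)"
      using card_image_le[of UNIV "\<lambda>i. y i - y0"] by simp
    finally have "dim (span (range (\<lambda>i. y i - y0))) \<le> DIM(real^'l)" .
    then obtain g :: "real^'l \<Rightarrow> real^'d" where g: "linear g" "\<And>x. norm (g x) = norm x"
      "span (range (\<lambda>i. y i - y0)) \<subseteq> range g"
      using isometric_embedding_exists[OF subspace_span, where 'a = "real^'l"] le by (metis DIM_cart DIM_real mult.right_neutral)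
    have "dist (y0 + g x) (y0 + g x') = dist x x'" for x x'
      using g(2)[of "x - x'"] by (simp add: dist_norm linear_diff[OF g(1)])
    moreover have "?S \<subseteq> range (\<lambda>x. y0 + g x)"
    proof (rule hull_minimal)
      have "y0 \<in> range (\<lambda>x. y0 + g x)"
        using linear_0[OF g(1)] by (auto simp: image_iff intro!: exI[of _ 0])
      moreover have "y i \<in> range (\<lambda>x. y0 + g x)" for i
      proof -
        have "y i - y0 \<in> range g" using g(3) span_base[of "y i - y0" "range (\<lambda>i. y i - y0)"] by auto
        then obtain x where "y i - y0 = g x" by auto
        hence "y i = y0 + g x" by (simp add: algebra_simps)
        thus ?thesis by auto
      qed
      ultimately show "insert y0 (range y) \<subseteq> range (\<lambda>x. y0 + g x)" by auto
      have "convex ((+) y0 ` range g)"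
        using g(1) by (intro convex_translation convex_linear_image) auto
      thus "convex (range (\<lambda>x. y0 + g x))" by (simp add: image_image)
    qed
    ultimately show ?thesis
      unfolding P_def by (intro exI[of _ "\<lambda>x. y0 + g x"] conjI allI)
  qed
  define f where "f = (SOME f. P f)"
  have "P f" unfolding f_def using \<open>\<exists>f. P f\<close> by (rule someI_ex)
  hence dist: "\<And>x x'. dist (f x) (f x') = dist x x'" and sub: "?S \<subseteq> range f"
    by (auto simp: P_def)
  define Q :: "(real, 'l wo) vec \<Rightarrow> real^'l" where "Q x = (\<chi> j. x $ to_wo j)" for x
  have bij: "bij (to_wo :: 'l \<Rightarrow> 'l wo)"
    by (metis UNIV_I bij_betw_def inj_def to_wo_inject surj_def of_wo_inverse)
  have Q: "linear Q" "norm (Q x) = norm x" for x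
  proof -
    show "linear Q" by (rule linearI) (auto simp: Q_def vec_eq_iff)
    show "norm (Q x) = norm x"
      unfolding norm_vec_def L2_set_def Q_def
      using sum.reindex_bij_betw[OF bij, of "\<lambda>i. (norm (x $ i))\<^sup>2"] by simp
  qed
  have surjQ: "Q (\<chi> i. x $ of_wo i) = x" for x
    by (simp add: Q_def vec_eq_iff to_wo_inverse)
  have Qmeas [measurable]: "Q \<in> borel_measurable borel"
    by (intro borel_measurable_continuous_onI linear_continuous_on linear_conv_bounded_linear[THEN iffD1] Q)
  define h where "h x = f (Q x)" for x
  have disth: "dist (h x) (h x') = dist x x'" for x x'
    unfolding h_def dist using Q(2)[of "x - x'"] by (simp add: dist_norm linear_diff[OF Q(1)])
  have injh: "inj h"
    by (rule injI) (metis disth dist_eq_0_iff)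
  have ex: "\<exists>x. h x = v" if "v \<in> ?S" for v
    using sub that surjQ unfolding h_def by (metis image_iff subsetD)
  obtain z0 where z0: "h z0 = y0"
    using ex[of y0] by (auto simp: hull_inc)
  have "\<forall>i. \<exists>x. h x = y i"
    using ex by (auto simp: hull_inc)
  then obtain z where z: "\<And>i. h (z i) = y i" by metis
  define L where "L x = h x - h 0" for x
  have L: "linear L" "L x \<bullet> L x' = x \<bullet> x'" for x x'
    unfolding L_def using isometry_linear_part[of h] disth by auto
  have hL: "h ` B = (+) (h 0) ` L ` B" for B
    unfolding image_image L_def by simp
  have "h ` (convex hull (insert z0 (range z))) = convex hull (h ` insert z0 (range z))"
    unfolding hL convex_hull_translation convex_hull_linear_image[OF L(1)] ..
  also have "h ` insert z0 (range z) = insert y0 (range y)"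
    by (simp add: z0 z image_image)
  finally have "h -` ?S = convex hull (insert z0 (range z))"
    using inj_vimage_image_eq[OF injh] by metis
  hence hS: "Q -` (f -` ?S) = convex hull (insert z0 (range z))"
    by (simp add: h_def vimage_def)
  have "continuous_on UNIV f"
    using dist by (auto simp: continuous_on_iff)
  hence "closed (f -` ?S)"
    by (intro continuous_closed_vimage compact_imp_closed finite_imp_compact_convex_hull)
       (auto simp: continuous_on_eq_continuous_at)
  hence S [measurable]: "f -` ?S \<in> sets borel" by simp
  have compact: "compact (convex hull (insert z0 (range z)))"
    by (intro finite_imp_compact_convex_hull) simp
  have "vol_l TYPE('l) ?S = measure lebesgue (f -` ?S)"
    by (simp add: vol_l_def f_def P_def)
  also have "\<dots> = measure (distr lborel borel Q) (f -` ?S)"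
    using Q by (subst lborel_distr_isometry) (auto simp: measure_completion)
  also have "\<dots> = measure lborel (convex hull (insert z0 (range z)))"
    by (subst measure_distr) (auto simp: hS)
  also have "\<dots> = measure lebesgue (convex hull (insert z0 (range z)))"
    using compact by (intro measure_completion[symmetric]) (auto dest: compact_imp_closed)
  also have "\<dots> = sqrt (gram (\<lambda>i. z i - z0)) / fact CARD('l)"
    by (simp add: measure_simplex_gram)
  also have "gram (\<lambda>i. z i - z0) = gram (\<lambda>i. y i - y0)"
  proof -
    have "y i - y0 = L (z i - z0)" for i
      by (simp add: linear_diff[OF L(1)]) (simp add: L_def z z0)
    thus ?thesis by (simp add: gram_def L(2))
  qed
  finally show ?thesis .
qed

section \<open>Moments of the Gram determinant\<close>

lemma gram_scale: "gram (\<lambda>i. c i *\<^sub>R V i) = (\<Prod>i\<in>UNIV. c i)\<^sup>2 * gram V"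
proof -
  define B where "B = (\<chi> i j. if i = j then c i else 0)"
  have "c i *\<^sub>R V i = (\<Sum>j\<in>UNIV. B $ i $ j *\<^sub>R V j)" for i
  proof -
    have "(\<Sum>j\<in>UNIV. B $ i $ j *\<^sub>R V j) = (\<Sum>j\<in>UNIV. if i = j then c i *\<^sub>R V i else 0)"
      by (intro sum.cong) (auto simp: B_def)
    thus ?thesis by simp
  qed
  moreover have "det B = (\<Prod>i\<in>UNIV. c i)"
    by (subst det_diagonal) (auto simp: B_def)
  ultimately show ?thesis by (simp add: gram_linear)
qed

text \<open>Numbering the family through the inverse of \<open>order_rank\<close> makes the
  Gram-Schmidt formula applicable, and that formula is a square.\<close>

lemma gram_nonneg: "gram (V :: 'm::{finite,wellorder} \<Rightarrow> 'a::real_inner) \<ge> 0"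
proof -
  have "inv order_rank (order_rank i) = i" for i :: 'm
    using bij_betw_order_rank[where 'm='m] by (simp add: bij_betw_def)
  hence "gram V = gram (\<lambda>i::'m. (\<lambda>k. V (inv order_rank k)) (order_rank i))" by simp
  also have "\<dots> = (\<Prod>k<CARD('m). norm (gs_res k (\<lambda>k. V (inv order_rank k)) (V (inv order_rank k))))\<^sup>2"
    by (rule gram_eq_prod_gs_res)
  finally show ?thesis by simp
qed

lemma borel_measurable_gram [measurable (raw)]:
  fixes V :: "'b \<Rightarrow> 'n::finite \<Rightarrow> 'a::euclidean_space"
  assumes [measurable]: "\<And>i. (\<lambda>w. V w i) \<in> borel_measurable M"
  shows "(\<lambda>w. gram (V w)) \<in> borel_measurable M"
  unfolding gram_def det_def by simp

text \<open>
  Rotating the rows of \<open>Z\<close> turns \<open>s\<close> into a multiple of a coordinate vector, so only one row \<open>Z\<^sub>k\<close>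
  still involves \<open>x\<close>; then \<open>Z\<^sub>k - |s| x\<close> is \<open>\<surd>(1 + |s|\<^sup>2)\<close> times a standard Gaussian vector.
\<close>
lemma nn_integral_gram_affine:
  fixes s :: "(real, 'n::{finite,wellorder}) vec"
  shows "(\<integral>\<^sup>+x. (\<integral>\<^sup>+Z. ennreal (sqrt (gram (\<lambda>i. Z $ i - s $ i *\<^sub>R x)) powr p) \<partial>(gauss :: ('a::euclidean_space, 'n) vec measure)) \<partial>gauss)
    = ennreal (sqrt (1 + (norm s)\<^sup>2) powr p) * (\<integral>\<^sup>+Z. ennreal (sqrt (gram (\<lambda>i. Z $ i)) powr p) \<partial>(gauss :: ('a, 'n) vec measure))"
proof -
  define F where "F V = ennreal (sqrt (gram V) powr p)" for V :: "'n \<Rightarrow> 'a"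
  have F_meas [measurable (raw)]: "(\<lambda>w. F (V w)) \<in> borel_measurable M"
    if "\<And>i. (\<lambda>w. V w i) \<in> borel_measurable M" for V :: "'c \<Rightarrow> 'n \<Rightarrow> 'a" and M
    using that unfolding F_def by measurable
  \<comment> \<open>Any index will do as the axis onto which \<open>s\<close> is rotated.\<close>
  define k :: 'n where "k = undefined"
  define r where "r = norm s"
  have "norm s = norm (r *\<^sub>R axis k (1::real))" by (simp add: r_def)
  then obtain f :: "(real, 'n) vec \<Rightarrow> (real, 'n) vec" where f: "orthogonal_transformation f" "f s = r *\<^sub>R axis k 1"
    by (rule orthogonal_transformation_exists)
  define A where "A = matrix f"
  have As: "(\<Sum>j\<in>UNIV. A $ i $ j * s $ j) = (if i = k then r else 0)" for i
  proof -
    have "A *v s = r *\<^sub>R axis k 1"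
      unfolding A_def using f by (simp add: matrix_works orthogonal_transformation_def)
    hence "(A *v s) $ i = (if i = k then r else 0)" by (simp add: axis_def)
    thus ?thesis by (simp add: matrix_vector_mult_def)
  qed
  have orth: "orthogonal_matrix A"
    using f by (simp add: A_def orthogonal_transformation_matrix)
  hence detA: "(det A)\<^sup>2 = 1"
    using det_orthogonal_matrix[OF orth] by auto
  have AA: "(\<Sum>i\<in>UNIV. A $ i $ j * A $ i $ j') = (if j = j' then 1 else 0)" for j j'
  proof -
    have "(transpose A ** A) $ j $ j' = (mat 1 :: ((real, 'n) vec, 'n) vec) $ j $ j'"
      using orth by (simp add: orthogonal_matrix)
    thus ?thesis by (simp add: matrix_matrix_mult_def transpose_def mat_def)
  qed
  define R :: "('a, 'n) vec \<Rightarrow> ('a, 'n) vec" where "R Z = (\<chi> i. \<Sum>j\<in>UNIV. A $ i $ j *\<^sub>R Z $ j)" for Z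
  have linR: "linear R"
    by (rule linearI) (auto simp: R_def vec_eq_iff sum.distrib scaleR_sum_right algebra_simps)
  have normR: "norm (R Z) = norm Z" for Z
  proof -
    have "R Z \<bullet> R Z = (\<Sum>i\<in>UNIV. \<Sum>j\<in>UNIV. \<Sum>j'\<in>UNIV. (A $ i $ j * A $ i $ j') * (Z $ j' \<bullet> Z $ j))"
      by (simp add: R_def inner_vec_def inner_sum_left inner_sum_right sum_distrib_left mult_ac)
    also have "\<dots> = (\<Sum>j\<in>UNIV. \<Sum>j'\<in>UNIV. \<Sum>i\<in>UNIV. (A $ i $ j * A $ i $ j') * (Z $ j' \<bullet> Z $ j))"
      by (rule trans[OF sum.swap], rule sum.cong[OF refl], rule sum.swap)
    also have "\<dots> = (\<Sum>j\<in>UNIV. \<Sum>j'\<in>UNIV. if j = j' then Z $ j \<bullet> Z $ j else 0)"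
      by (intro sum.cong refl) (simp add: sum_distrib_right[symmetric] AA)
    also have "\<dots> = Z \<bullet> Z" by (simp add: inner_vec_def)
    finally show ?thesis by (simp add: norm_eq_sqrt_inner)
  qed
  have R_meas [measurable]: "R \<in> borel_measurable borel"
    by (intro borel_measurable_continuous_onI linear_continuous_on linear_conv_bounded_linear[THEN iffD1] linR)
  let ?d = "\<lambda>i. if i = k then r else 0"
  have rot: "F (\<lambda>i. Z $ i - s $ i *\<^sub>R x) = F (\<lambda>i. R Z $ i - ?d i *\<^sub>R x)" for Z x
  proof -
    have "R Z $ i - ?d i *\<^sub>R x = (\<Sum>j\<in>UNIV. A $ i $ j *\<^sub>R (Z $ j - s $ j *\<^sub>R x))" for i
      unfolding As[symmetric] R_def by (simp add: sum_subtractf scaleR_sum_left scaleR_diff_right)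
    thus ?thesis by (simp add: F_def gram_linear detA)
  qed
  \<comment> \<open>\<open>c\<close> and \<open>t\<close> are the cosine and sine of the angle with
    tangent \<open>r\<close>: the row \<open>Z $ k - r *\<^sub>R x\<close> is \<open>1 / c\<close>
    times \<open>c *\<^sub>R Z $ k - t *\<^sub>R x\<close>, which is one component of a rotation of
    the pair of \<open>x\<close> and \<open>Z $ k\<close>.\<close>
  define c where "c = 1 / sqrt (1 + r\<^sup>2)"
  define t where "t = r * c"
  have pos: "1 + r\<^sup>2 > 0" by (simp add: add_pos_nonneg)
  have c0: "c > 0" using pos by (simp add: c_def)
  have "c\<^sup>2 * (1 + r\<^sup>2) = 1" using pos by (simp add: c_def power_divide)
  hence ct: "c\<^sup>2 + t\<^sup>2 = 1" by (simp add: t_def power_mult_distrib algebra_simps)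
  define \<Phi> :: "'a \<times> ('a, 'n) vec \<Rightarrow> 'a \<times> ('a, 'n) vec" where
    "\<Phi> = (\<lambda>(x, Z). (c *\<^sub>R x + t *\<^sub>R Z $ k, \<chi> i. if i = k then c *\<^sub>R Z $ k - t *\<^sub>R x else Z $ i))"
  have lin\<Phi>: "linear \<Phi>"
    by (rule linearI) (auto simp: \<Phi>_def vec_eq_iff algebra_simps)
  have norm\<Phi>: "norm (\<Phi> w) = norm w" for w
  proof -
    obtain x Z where w: "w = (x, Z)" by (cases w)
    define a b where "a = x" and "b = Z $ k"
    have eq: "(c *\<^sub>R a + t *\<^sub>R b) \<bullet> (c *\<^sub>R a + t *\<^sub>R b) + (c *\<^sub>R b - t *\<^sub>R a) \<bullet> (c *\<^sub>R b - t *\<^sub>R a)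
        = (c\<^sup>2 + t\<^sup>2) * (a \<bullet> a) + (c\<^sup>2 + t\<^sup>2) * (b \<bullet> b)"
      by (simp add: inner_add_left inner_add_right inner_diff_left inner_diff_right inner_commute
          power2_eq_square algebra_simps)
    have "\<Phi> w \<bullet> \<Phi> w = (c *\<^sub>R a + t *\<^sub>R b) \<bullet> (c *\<^sub>R a + t *\<^sub>R b) + (c *\<^sub>R b - t *\<^sub>R a) \<bullet> (c *\<^sub>R b - t *\<^sub>R a)
        + (\<Sum>i\<in>UNIV - {k}. Z $ i \<bullet> Z $ i)"
      by (simp add: \<Phi>_def w inner_prod_def inner_vec_def a_def b_def sum.remove[of UNIV k])
    also have "\<dots> = w \<bullet> w"
      unfolding eq ct by (simp add: w inner_prod_def inner_vec_def a_def b_def sum.remove[of UNIV k])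
    finally show ?thesis by (simp add: norm_eq_sqrt_inner)
  qed
  have \<Phi>_meas [measurable]: "\<Phi> \<in> borel_measurable borel"
    by (intro borel_measurable_continuous_onI linear_continuous_on linear_conv_bounded_linear[THEN iffD1] lin\<Phi>)
  have [measurable]: "snd \<in> borel_measurable (borel :: ('a \<times> ('a, 'n) vec) measure)"
    by (intro borel_measurable_continuous_onI continuous_intros)
  have [measurable]: "(\<lambda>w. snd (\<Phi> w)) \<in> borel_measurable borel"
    by (rule measurable_compose[OF \<Phi>_meas]) measurable
  have scale: "F (\<lambda>i. Z $ i - ?d i *\<^sub>R x) = ennreal (sqrt (1 + r\<^sup>2) powr p) * F (\<lambda>i. snd (\<Phi> (x, Z)) $ i)" for x Z
  proof -
    have "Z $ i - ?d i *\<^sub>R x = (if i = k then 1 / c else 1) *\<^sub>R (snd (\<Phi> (x, Z)) $ i)" for i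
      using c0 by (simp add: \<Phi>_def t_def algebra_simps)
    hence "gram (\<lambda>i. Z $ i - ?d i *\<^sub>R x) = (1 / c)\<^sup>2 * gram (\<lambda>i. snd (\<Phi> (x, Z)) $ i)"
      by (simp only: gram_scale) simp
    hence "sqrt (gram (\<lambda>i. Z $ i - ?d i *\<^sub>R x)) = sqrt (1 + r\<^sup>2) * sqrt (gram (\<lambda>i. snd (\<Phi> (x, Z)) $ i))"
      using pos by (simp add: c_def real_sqrt_mult)
    thus ?thesis
      using gram_nonneg pos by (simp add: F_def powr_mult ennreal_mult')
  qed
  interpret G: pair_sigma_finite "gauss :: 'a measure" "gauss :: ('a, 'n) vec measure"
    by (simp add: pair_sigma_finite_def prob_space_gauss prob_space_imp_sigma_finite)
  have one: "emeasure (gauss :: 'a measure) UNIV = 1"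
    using prob_space.emeasure_space_1[OF prob_space_gauss[where 'a='a]] by simp
  have "(\<integral>\<^sup>+x. (\<integral>\<^sup>+Z. F (\<lambda>i. Z $ i - s $ i *\<^sub>R x) \<partial>gauss) \<partial>gauss)
      = (\<integral>\<^sup>+x. (\<integral>\<^sup>+Z. F (\<lambda>i. Z $ i - ?d i *\<^sub>R x) \<partial>distr gauss borel R) \<partial>gauss)"
    by (subst nn_integral_distr) (auto simp: rot)
  also have "distr gauss borel R = gauss"
    using linR normR by (rule gauss_distr_isometry) simp
  also have "(\<integral>\<^sup>+x. (\<integral>\<^sup>+Z. F (\<lambda>i. Z $ i - ?d i *\<^sub>R x) \<partial>gauss) \<partial>gauss)
      = (\<integral>\<^sup>+w. F (\<lambda>i. snd w $ i - ?d i *\<^sub>R fst w) \<partial>(gauss \<Otimes>\<^sub>M gauss))"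
    by (subst G.M2.nn_integral_fst[symmetric]) auto
  also have "\<dots> = (\<integral>\<^sup>+w. ennreal (sqrt (1 + r\<^sup>2) powr p) * F (\<lambda>i. snd (\<Phi> w) $ i) \<partial>gauss)"
    unfolding gauss_pair by (intro nn_integral_cong) (simp add: scale)
  also have "\<dots> = ennreal (sqrt (1 + r\<^sup>2) powr p) * (\<integral>\<^sup>+w. F (\<lambda>i. snd (\<Phi> w) $ i) \<partial>gauss)"
    by (intro nn_integral_cmult) measurable
  also have "(\<integral>\<^sup>+w. F (\<lambda>i. snd (\<Phi> w) $ i) \<partial>gauss) = (\<integral>\<^sup>+w. F (\<lambda>i. snd w $ i) \<partial>distr gauss borel \<Phi>)"
    by (subst nn_integral_distr) auto
  also have "distr gauss borel \<Phi> = gauss \<Otimes>\<^sub>M gauss"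
    unfolding gauss_pair using lin\<Phi> norm\<Phi> by (rule gauss_distr_isometry) simp
  \<comment> \<open>After the rotation the integrand depends on the second component only, and the
    first integrates to 1.\<close>
  also have "(\<integral>\<^sup>+w. F (\<lambda>i. snd w $ i) \<partial>((gauss :: 'a measure) \<Otimes>\<^sub>M gauss)) = (\<integral>\<^sup>+Z. F (\<lambda>i. Z $ i) \<partial>gauss)"
    by (subst G.M2.nn_integral_fst[symmetric]) (auto simp: one)
  finally show ?thesis by (simp add: F_def r_def)
qed

lemma nn_integral_gram:
  assumes p: "p > 0" and le: "CARD('m::{finite,wellorder}) \<le> DIM('a::euclidean_space)"
  shows "(\<integral>\<^sup>+Z. ennreal (sqrt (gram (\<lambda>i. Z $ i)) powr p) \<partial>(gauss :: ('a, 'm) vec measure))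
    = ennreal (\<Prod>k<CARD('m). 2 powr (p / 2) * Gamma ((real (DIM('a) - k) + p) / 2) / Gamma (real (DIM('a) - k) / 2))"
proof -
  have "(\<integral>\<^sup>+Z. ennreal (sqrt (gram (\<lambda>i. Z $ i)) powr p) \<partial>(gauss :: ('a, 'm) vec measure))
    = (\<integral>\<^sup>+G. ennreal (sqrt (gram (\<lambda>i::'m. G (order_rank i))) powr p) \<partial>PiM {..<CARD('m)} (\<lambda>_. gauss :: 'a measure))"
    using bij_betwE[OF bij_betw_order_rank[where 'm='m]]
    by (subst gauss_vec_reindex[OF bij_betw_order_rank, symmetric], subst nn_integral_distr) (auto simp: vec_lambda_inverse)
  also have "\<dots> = (\<integral>\<^sup>+G. ennreal ((\<Prod>k<CARD('m). norm (gs_res k G (G k))) powr p) \<partial>PiM {..<CARD('m)} (\<lambda>_. gauss :: 'a measure))"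
    by (simp add: gram_eq_prod_gs_res prod_nonneg)
  also note nn_integral_prod_gs_res[OF p le]
  finally show ?thesis .
qed

section \<open>Moments of the volume of a simplex with scaled Gaussian vertices\<close>

theorem theorem6:
  fixes M :: "'w measure"
    and X :: "nat \<Rightarrow> 'w \<Rightarrow> real^'d::finite"
    and \<sigma> :: "nat \<Rightarrow> real"
    and p :: real
  assumes "prob_space M"
    and "CARD('l::finite) \<le> CARD('d)"
    and "prob_space.indep_vars M (\<lambda>_. borel) X {0..CARD('l)}"
    and "\<And>i. i \<le> CARD('l) \<Longrightarrow> distr M borel (X i) = std_gaussian"
    and "\<And>i. i \<le> CARD('l) \<Longrightarrow> \<sigma> i > 0"
    and "p > 0"
  shows "prob_space.expectation M
           (\<lambda>\<omega>. vol_l TYPE('l) (convex hull {\<sigma> i *\<^sub>R X i \<omega> | i. i \<le> CARD('l)}) powr p)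
       = (2 powr (real CARD('l) / 2) * (\<Prod>i\<le>CARD('l). \<sigma> i) / fact CARD('l)
            * sqrt (\<Sum>i\<le>CARD('l). 1 / (\<sigma> i)\<^sup>2)) powr p
         * (\<Prod>i = CARD('d) - CARD('l) + 1 .. CARD('d).
              Gamma ((real i + p) / 2) / Gamma (real i / 2))"
proof -
  let ?l = "CARD('l)" and ?d = "CARD('d)"
  note le = assms(2) and \<sigma> = assms(5) and p = assms(6)
  interpret prob_space M by fact
  interpret product_sigma_finite "\<lambda>_::nat. gauss :: (real^'d) measure"
    by (simp add: product_sigma_finite_def prob_space_gauss prob_space_imp_sigma_finite)
  \<comment> \<open>Rows are numbered from 1, because index 0 belongs to the base vertex of the
    simplex.\<close>
  define e :: "'l wo \<Rightarrow> nat" where "e i = Suc (order_rank i)" for i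
  have e: "bij_betw e UNIV {1..?l}"
  proof -
    have "bij_betw (Suc \<circ> order_rank) (UNIV :: 'l wo set) {1..?l}"
      by (rule bij_betw_trans[OF bij_betw_order_rank])
         (auto simp: bij_betw_def image_Suc_lessThan)
    thus ?thesis by (simp add: e_def[abs_def] o_def)
  qed
  have eI: "e i \<in> {1..?l}" for i using bij_betwE[OF e] by auto
  have e0: "e i \<noteq> 0" for i by (simp add: e_def)
  define s :: "(real, 'l wo) vec" where "s = (\<chi> i. \<sigma> 0 / \<sigma> (e i))"
  \<comment> \<open>\<open>C\<close> gathers 1/l! and the factors pulled out of the edges;
    \<sigma>_0 is not among them, since it enters only through \<open>s\<close>.\<close>
  define C where "C = (\<Prod>i\<in>UNIV. \<sigma> (e i)) / fact ?l"
  define F where "F V = ennreal (sqrt (gram V) powr p)" for V :: "'l wo \<Rightarrow> real^'d"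
  have \<sigma>e: "\<sigma> (e i) > 0" for i using eI[of i] \<sigma> by auto
  have C: "C > 0" by (simp add: C_def prod_pos \<sigma>e)
  have rv: "X i \<in> borel_measurable M" if "i \<le> ?l" for i
    using assms(3) that by (auto simp: indep_vars_def)
  have joint: "distr M (PiM {0..?l} (\<lambda>_. borel)) (\<lambda>\<omega>. \<lambda>i\<in>{0..?l}. X i \<omega>) = PiM {0..?l} (\<lambda>_. gauss)"
  proof -
    have "distr M (PiM {0..?l} (\<lambda>_. borel)) (\<lambda>\<omega>. \<lambda>i\<in>{0..?l}. X i \<omega>) = PiM {0..?l} (\<lambda>i. distr M borel (X i))"
      using assms(3) rv by (subst indep_vars_iff_distr_eq_PiM'[symmetric]) auto
    also have "\<dots> = PiM {0..?l} (\<lambda>_. gauss)"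
      using assms(4) by (intro PiM_cong) (auto simp: std_gaussian_eq_gauss)
    finally show ?thesis .
  qed
  have vol: "vol_l TYPE('l) (convex hull {\<sigma> i *\<^sub>R X i \<omega> | i. i \<le> ?l})
      = C * sqrt (gram (\<lambda>i. X (e i) \<omega> - s $ i *\<^sub>R X 0 \<omega>))" for \<omega>
  proof -
    have "{..?l} = insert 0 (range e)"
      using bij_betw_imp_surj_on[OF e] by auto
    hence "{\<sigma> i *\<^sub>R X i \<omega> | i. i \<le> ?l} = (\<lambda>i. \<sigma> i *\<^sub>R X i \<omega>) ` insert 0 (range e)"
      by (auto simp: set_eq_iff image_iff)
    also have "\<dots> = insert (\<sigma> 0 *\<^sub>R X 0 \<omega>) (range (\<lambda>i. \<sigma> (e i) *\<^sub>R X (e i) \<omega>))"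
      by (simp add: image_image)
    finally have "vol_l TYPE('l) (convex hull {\<sigma> i *\<^sub>R X i \<omega> | i. i \<le> ?l})
        = sqrt (gram (\<lambda>i. \<sigma> (e i) *\<^sub>R X (e i) \<omega> - \<sigma> 0 *\<^sub>R X 0 \<omega>)) / fact ?l"
      using le by (simp add: vol_l_simplex)
    also have "(\<lambda>i. \<sigma> (e i) *\<^sub>R X (e i) \<omega> - \<sigma> 0 *\<^sub>R X 0 \<omega>) = (\<lambda>i. \<sigma> (e i) *\<^sub>R (X (e i) \<omega> - s $ i *\<^sub>R X 0 \<omega>))"
      using \<sigma>e by (auto simp: s_def algebra_simps less_imp_neq[THEN not_sym])
    finally show ?thesis
      using prod_pos[of UNIV "\<lambda>i. \<sigma> (e i)"] \<sigma>e by (simp add: gram_scale real_sqrt_mult C_def)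
  qed
  \<comment> \<open>The summand 1 is the term \<open>i = 0\<close> of the sum multiplied by
    \<sigma>_0^2, and the square root of \<sigma>_0^2 supplies the factor missing from
    \<open>C\<close>.\<close>
  have s2: "C * sqrt (1 + (norm s)\<^sup>2) = (\<Prod>i\<le>?l. \<sigma> i) / fact ?l * sqrt (\<Sum>i\<le>?l. 1 / (\<sigma> i)\<^sup>2)"
  proof -
    have split: "{..?l} = insert 0 {1..?l}" by auto
    have "(norm s)\<^sup>2 = (\<Sum>i\<in>UNIV. (\<sigma> 0)\<^sup>2 * (1 / (\<sigma> (e i))\<^sup>2))"
      by (simp add: norm_vec_def L2_set_def sum_nonneg s_def power_divide)
    also have "\<dots> = (\<sigma> 0)\<^sup>2 * (\<Sum>i\<in>{1..?l}. 1 / (\<sigma> i)\<^sup>2)"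
      by (simp only: sum_distrib_left[symmetric] sum.reindex_bij_betw[OF e, of "\<lambda>i. 1 / (\<sigma> i)\<^sup>2"])
    finally have "1 + (norm s)\<^sup>2 = (\<sigma> 0)\<^sup>2 * (\<Sum>i\<le>?l. 1 / (\<sigma> i)\<^sup>2)"
      using \<sigma>[of 0] unfolding split by (simp add: distrib_left)
    moreover have "C = (\<Prod>i\<in>{1..?l}. \<sigma> i) / fact ?l"
      unfolding C_def by (simp only: prod.reindex_bij_betw[OF e, of \<sigma>])
    moreover have "(\<Prod>i\<le>?l. \<sigma> i) = \<sigma> 0 * (\<Prod>i\<in>{1..?l}. \<sigma> i)"
      unfolding split by simp
    ultimately show ?thesis
      using \<sigma>[of 0] by (simp add: real_sqrt_mult)
  qed
  let ?K = "\<lambda>k. 2 powr (p / 2) * Gamma ((real (?d - k) + p) / 2) / Gamma (real (?d - k) / 2)"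
  have K: "?K k > 0" if "k < ?l" for k
    using that le p by (intro divide_pos_pos mult_pos_pos Gamma_real_pos) auto
  have K': "(\<Prod>k<?l. ?K k) \<ge> 0"
    using K by (intro prod_nonneg) (auto intro: less_imp_le)
  \<comment> \<open>The degrees of freedom \<open>?d - k\<close> become the index \<open>i\<close>
    of the product in the theorem.\<close>
  have prodK: "(\<Prod>k<?l. ?K k) = (2 powr (real ?l / 2)) powr p
      * (\<Prod>i = ?d - ?l + 1 .. ?d. Gamma ((real i + p) / 2) / Gamma (real i / 2))"
  proof -
    have "bij_betw (\<lambda>k. ?d - k) {..<?l} {?d - ?l + 1..?d}"
      using le by (intro bij_betwI[of _ _ _ "\<lambda>i. ?d - i"]) auto
    hence "(\<Prod>k<?l. Gamma ((real (?d - k) + p) / 2) / Gamma (real (?d - k) / 2))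
      = (\<Prod>i = ?d - ?l + 1 .. ?d. Gamma ((real i + p) / 2) / Gamma (real i / 2))"
      by (rule prod.reindex_bij_betw)
    moreover have "(\<Prod>k<?l. 2 powr (p / 2) :: real) = (2 powr (real ?l / 2)) powr p"
      by (simp add: powr_realpow[symmetric] powr_powr mult_ac)
    ultimately show ?thesis
      by (simp only: prod.distrib times_divide_eq_right[symmetric])
  qed
  have [measurable]: "(\<lambda>\<omega>. \<lambda>i\<in>{0..?l}. X i \<omega>) \<in> measurable M (PiM {0..?l} (\<lambda>_. borel))"
    using rv by (intro measurable_restrict) auto
  have X_meas [measurable]: "X 0 \<in> borel_measurable M" "X (e i) \<in> borel_measurable M" for i
    using rv eI[of i] by auto
  have F_meas [measurable (raw)]: "(\<lambda>w. F (V w)) \<in> borel_measurable N"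
    if "\<And>i. (\<lambda>w. V w i) \<in> borel_measurable N" for V :: "'c \<Rightarrow> 'l wo \<Rightarrow> real^'d" and N
    using that unfolding F_def by measurable
  have comp [measurable]: "(\<lambda>H. H (e i)) \<in> borel_measurable (PiM {0..?l} (\<lambda>_. borel :: (real^'d) measure))"
      "(\<lambda>H. H 0) \<in> borel_measurable (PiM {0..?l} (\<lambda>_. borel :: (real^'d) measure))"
      "(\<lambda>H. H (e i)) \<in> borel_measurable (PiM {1..?l} (\<lambda>_. gauss :: (real^'d) measure))"
      "(\<lambda>H. H (e i)) \<in> borel_measurable (PiM (insert 0 {1..?l}) (\<lambda>_. gauss :: (real^'d) measure))"
      "(\<lambda>H. H 0) \<in> borel_measurable (PiM (insert 0 {1..?l}) (\<lambda>_. gauss :: (real^'d) measure))" for i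
    using eI[of i] by auto
  have "(\<integral>\<^sup>+\<omega>. ennreal (vol_l TYPE('l) (convex hull {\<sigma> i *\<^sub>R X i \<omega> | i. i \<le> ?l}) powr p) \<partial>M)
      = (\<integral>\<^sup>+\<omega>. ennreal (C powr p) * F (\<lambda>i. X (e i) \<omega> - s $ i *\<^sub>R X 0 \<omega>) \<partial>M)"
    unfolding vol F_def using C by (simp add: powr_mult gram_nonneg ennreal_mult)
  also have "\<dots> = ennreal (C powr p) * (\<integral>\<^sup>+\<omega>. F (\<lambda>i. X (e i) \<omega> - s $ i *\<^sub>R X 0 \<omega>) \<partial>M)"
    by (intro nn_integral_cmult) measurable
  also have "(\<integral>\<^sup>+\<omega>. F (\<lambda>i. X (e i) \<omega> - s $ i *\<^sub>R X 0 \<omega>) \<partial>M)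
      = (\<integral>\<^sup>+H. F (\<lambda>i. H (e i) - s $ i *\<^sub>R H 0) \<partial>PiM {0..?l} (\<lambda>_. gauss))"
    using eI unfolding joint[symmetric] by (subst nn_integral_distr) auto
  also have "{0..?l} = insert 0 {1..?l}" by auto
  \<comment> \<open>The base vertex is split off as the outer variable, so that the inner integral
    runs over the rows alone.\<close>
  also have "(\<integral>\<^sup>+H. F (\<lambda>i. H (e i) - s $ i *\<^sub>R H 0) \<partial>PiM (insert 0 {1..?l}) (\<lambda>_. gauss))
      = (\<integral>\<^sup>+x. (\<integral>\<^sup>+G. F (\<lambda>i. (G(0 := x)) (e i) - s $ i *\<^sub>R (G(0 := x)) 0) \<partial>PiM {1..?l} (\<lambda>_. gauss)) \<partial>gauss)"
    by (rule product_nn_integral_insert_rev, simp, simp, measurable)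
  also have "\<dots> = (\<integral>\<^sup>+x. (\<integral>\<^sup>+Z. F (\<lambda>i. Z $ i - s $ i *\<^sub>R x) \<partial>gauss) \<partial>gauss)"
    by (subst gauss_vec_reindex[OF e, symmetric], subst nn_integral_distr) (auto simp: e0 simp del: One_nat_def)
  also have "\<dots> = ennreal (sqrt (1 + (norm s)\<^sup>2) powr p) * (\<integral>\<^sup>+Z. F (\<lambda>i. Z $ i) \<partial>gauss)"
    unfolding F_def by (rule nn_integral_gram_affine)
  also have "(\<integral>\<^sup>+Z. F (\<lambda>i. Z $ i) \<partial>gauss) = ennreal (\<Prod>k<?l. ?K k)"
    unfolding F_def using nn_integral_gram[OF p, where 'm = "'l wo" and 'a = "real^'d"] le by simp
  also have "ennreal (C powr p) * (ennreal (sqrt (1 + (norm s)\<^sup>2) powr p) * ennreal (\<Prod>k<?l. ?K k))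
      = ennreal ((C * sqrt (1 + (norm s)\<^sup>2)) powr p * (\<Prod>k<?l. ?K k))"
    using C K' by (simp add: ennreal_mult powr_mult mult.assoc)
  also have "(C * sqrt (1 + (norm s)\<^sup>2)) powr p * (\<Prod>k<?l. ?K k)
      = (2 powr (real ?l / 2) * (\<Prod>i\<le>?l. \<sigma> i) / fact ?l * sqrt (\<Sum>i\<le>?l. 1 / (\<sigma> i)\<^sup>2)) powr p
         * (\<Prod>i = ?d - ?l + 1 .. ?d. Gamma ((real i + p) / 2) / Gamma (real i / 2))" (is "_ = ?R")
  proof -
    have "C * sqrt (1 + (norm s)\<^sup>2) \<ge> 0" using C by simp
    hence "(C * sqrt (1 + (norm s)\<^sup>2)) powr p * (2 powr (real ?l / 2)) powr p
        = (2 powr (real ?l / 2) * (C * sqrt (1 + (norm s)\<^sup>2))) powr p"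
      by (simp add: powr_mult mult.commute)
    thus ?thesis
      unfolding prodK s2 by (simp add: mult.assoc[symmetric])
  qed
  finally have "(\<integral>\<^sup>+\<omega>. ennreal (vol_l TYPE('l) (convex hull {\<sigma> i *\<^sub>R X i \<omega> | i. i \<le> ?l}) powr p) \<partial>M) = ennreal ?R" .
  moreover have "?R \<ge> 0"
    using p by (intro mult_nonneg_nonneg prod_nonneg divide_nonneg_nonneg less_imp_le[OF Gamma_real_pos]) auto
  moreover have "(\<lambda>\<omega>. vol_l TYPE('l) (convex hull {\<sigma> i *\<^sub>R X i \<omega> | i. i \<le> ?l}) powr p) \<in> borel_measurable M"
    unfolding vol by measurable
  \<comment> \<open>A measurable nonnegative function has its expectation given by the nonnegative
    integral, whose value here is finite.\<close>
  ultimately show ?thesis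
    by (subst integral_eq_nn_integral) auto
qed

end
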